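(* Suppose Assumption A (see context) holds, let $D_g\ge\operatorname{diam}(\operatorname{dom}(g_2))$ be a fixed diameter bound, let $B_f\ge1$ be a Lipschitz constant for $f$ on $\operatorname{dom}(g_2)$, and let $(l_0,\Delta,x_f,M_\Delta)$ be a reference certificate (see context). For every $c\ge l_0$, $0<\delta\le1/B_f$ and $x_{\rm in}\in\operatorname{dom}(g_2)$, the call $(x_c,z_c)=$ VTest$(c,\delta,x_{\rm in})$ satisfies $$x_c\in\operatorname{dom}(g_2),\quad z_c\in[0,2M_\Delta),\quad f(x_c)-c\le\delta,\quad|g(x_c)-\bar g(c)|\le\delta.$$ For $d_c(z):=\inf_{x\in\operatorname{dom}(g_2)}\{g(x)+z(f(x)-c)\}$, the returned pair also satisfies $$\bar g(c)\ge d_c(z_c)>g(x_c)-(D_g^2+2)\delta.$$ The oracle call has operation complexity $$\mathcal O\!\left(\sqrt{\frac{C_D(L_{g_1}+M_\Delta L_{f_1})}{\delta}}\left(1+\log\frac1\delta\right)^2\right).$$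
   Context: **Problem.** $f=f_1+f_2$, $g=g_1+g_2$ on $\mathbb R^n$; $f_1,g_1:\mathbb R^n\to\mathbb R$ are convex and continuously differentiable with gradients Lipschitz with constants $L_{f_1}>0$, $L_{g_1}\ge1$; $f_2,g_2:\mathbb R^n\to\mathbb R\cup\{+\infty\}$ are proper, l.s.c., convex. (SBO) is: $\min_x f(x)$ s.t. $x\in\arg\min_{z\in\mathbb R^n}g(z)$. The lower-level and SBO solution sets are assumed nonempty. $g^*=\min_{\operatorname{dom}(g_2)}g$, $f^*=\min_{\operatorname{dom}(g_2)}f$, $p^*$ is the optimal value of (SBO), and $\bar g(c)=\min\{g(x):f(x)\le c\}$. **Assumption A.** (i) The restriction of $g_2$ to $\operatorname{dom}(g_2)$ is continuous; $\operatorname{dom}(g_2)$ is nonempty, compact, convex; $\operatorname{dom}(g_2)\subseteq\operatorname{dom}(f_2)$; $f_2$ is $l_{f_2}$-Lipschitz on $\operatorname{dom}(g_2)$. (ii) $p^*>f^*$. **Reference certificate.** A tuple $(l_0,\Delta,x_f,M_\Delta)$ such that $x_f\in\operatorname{dom}(g_2)$, $f^*<l_0<p^*$, $l_0=f(x_f)+\Delta$, $\Delta>0$, and there exists $x_g^{\rm ref}\in\operatorname{dom}(g_2)$ with $g(x_g^{\rm ref})-g^*\le1$ and $M_\Delta=\max\{(g(x_f)-g(x_g^{\rm ref})+1)/\Delta,\,1\}$. **Constants.** $C_D=1+D_g(1+D_g)$, $C_\Delta=4C_DM_\Delta$, $[a]_+=\max\{a,0\}$. **Operations and $\mathcal O$.**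 A basic operation is one evaluation of $f_1,f_2,g_1,g_2,\nabla f_1,\nabla g_1$, $\operatorname{prox}_{\tau(g_2+\theta f_2)}$ or $\operatorname{prox}_{\tau(f_2+I_{\operatorname{dom}(g_2)})}$ ($\tau>0$, $\theta\ge0$; $I_C$ is the indicator function of $C$, equal to $0$ on $C$ and $+\infty$ elsewhere). The constant hidden in $\mathcal O$ is independent of $\delta$, $c$ and $x_{\rm in}$; it may depend (through logarithmic factors) on the fixed problem data and the reference certificate. **Black-box ${\rm APG}_\mu$.** For $\varphi=\varphi_1+\varphi_2$ with $\varphi_1$ $\mu$-strongly convex ($\mu>0$), differentiable with $L_{\varphi_1}$-Lipschitz gradient, $\varphi_2$ proper l.s.c. convex with computable prox and $\operatorname{diam}(\operatorname{dom}\varphi_2)\le D$, $\delta'>0$, $x_{\rm init}\in\operatorname{dom}(\varphi_2)$: ${\rm APG}_\mu(\varphi_1,\varphi_2,\delta',x_{\rm init})$ returns $\tilde x\in\operatorname{dom}(\varphi_2)$ with $\operatorname{dist}(0,\partial\varphi(\tilde x))\le\delta'$ using $\mathcal O(\sqrt{L_{\varphi_1}/\mu}(1+\lceil\log_2(L_{\varphi_1}D/\delta')\rceil_+))$ proximal-gradient operations, each using a bounded number of basic operations ($\lceil a\rceil_+$ is the smallest nonnegative integer $\ge a$). **Routine Dual$(\phi,\psi,\sigma,M,x_{\rm init};\delta')$**, $\phi=\phi_1+\phi_2$ with $\phi_1$ $\mu_{\phi_1}$-strongly convex, $\psi=\psi_1+\psi_2$. Set $\varepsilon_1=\mu_{\phi_1}\delta'^2$,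 $\varepsilon_2=\delta'$, $\varepsilon_3=4M\delta'$ and $A(z)={\rm APG}_\mu(\phi_1+z\psi_1,\phi_2+z\psi_2,\varepsilon_1,x_{\rm init})$. *Interval search*: $\tilde x=A(0)$; if $[\psi(\tilde x)]_+\le\varepsilon_2$ return $(\tilde x,0)$. Else $a=0$, $b=\sigma$, $\tilde x_a=\tilde x$, $\tilde x_b=A(b)$; while $[\psi(\tilde x_b)]_+>\varepsilon_2$ and $b<M$: $a\gets b$, $b\gets2b$, $\tilde x_a\gets\tilde x_b$, $\tilde x_b\gets A(b)$. If $|b\psi(\tilde x_b)|\le\varepsilon_3$ return $(\tilde x_b,b)$. *Bisection*: otherwise, while $b-a>\mu_{\phi_1}\delta'^3$: $z=(a+b)/2$, $x=A(z)$; if $[\psi(x)]_+>\varepsilon_2$ set $a\gets z,\tilde x_a\gets x$; else if $|z\psi(x)|\le\varepsilon_3$ return $(x,z)$; else $b\gets z,\tilde x_b\gets x$. On loop exit return $(\tilde x_b,b)$. **VTest.** VTest$(c,\delta,x_{\rm in})=$ Dual$(G_\eta,f-c,1,M_\Delta,x_{\rm in};\delta/C_\Delta)$ with $\eta=\delta/C_D$, $G_\eta=g+\frac\eta2\|\cdot-x_f\|^2$, and the decomposition $\phi_1=g_1+\frac\eta2\|\cdot-x_f\|^2$, $\phi_2=g_2$, $\psi_1=f_1-c$, $\psi_2=f_2$, $\mu_{\phi_1}=\eta$. *)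

theory Defs
  imports "HOL-Analysis.Analysis"
begin

definition edom :: "('a \<Rightarrow> ereal) \<Rightarrow> 'a set"
  where "edom h = {x. h x < \<infinity>}"

definition proper :: "('a \<Rightarrow> ereal) \<Rightarrow> bool"
  where "proper h \<longleftrightarrow> edom h \<noteq> {} \<and> (\<forall>x. h x \<noteq> -\<infinity>)"

definition lsc :: "('a::topological_space \<Rightarrow> ereal) \<Rightarrow> bool"
  where "lsc h \<longleftrightarrow> (\<forall>x. h x \<le> Liminf (at x) h)"

text \<open>Here and below a zero coefficient annihilates \<^term>\<open>\<infinity>\<close>, since \<^term>\<open>0 * (\<infinity>::ereal)\<close> is
  \<^term>\<open>0::ereal\<close>; in particular \<open>h\<^sub>1 + 0 h\<^sub>2 = h\<^sub>1\<close> as extended-valued functions.\<close>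

definition convex_ereal :: "('a::real_vector \<Rightarrow> ereal) \<Rightarrow> bool"
  where "convex_ereal h \<longleftrightarrow>
    (\<forall>x y. \<forall>u\<ge>0. \<forall>v\<ge>0. u + v = 1 \<longrightarrow>
      h (u *\<^sub>R x + v *\<^sub>R y) \<le> ereal u * h x + ereal v * h y)"

definition strongly_convex :: "real \<Rightarrow> ('a::real_normed_vector \<Rightarrow> real) \<Rightarrow> bool"
  where "strongly_convex \<mu> h \<longleftrightarrow>
    (\<forall>x y. \<forall>u\<ge>0. \<forall>v\<ge>0. u + v = 1 \<longrightarrow>
      h (u *\<^sub>R x + v *\<^sub>R y) \<le> u * h x + v * h y - \<mu> / 2 * u * v * (norm (x - y))\<^sup>2)"

text \<open>A Lipschitz gradient is continuous, so this includes continuous differentiability.\<close>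

definition lipschitz_gradient :: "real \<Rightarrow> ('a::real_inner \<Rightarrow> real) \<Rightarrow> bool"
  where "lipschitz_gradient L h \<longleftrightarrow>
    (\<exists>grad. (\<forall>x. GDERIV h x :> grad x) \<and> L-lipschitz_on UNIV grad)"

definition subdifferential :: "('a::real_inner \<Rightarrow> ereal) \<Rightarrow> 'a \<Rightarrow> 'a set"
  where "subdifferential h x =
    {v. \<bar>h x\<bar> \<noteq> \<infinity> \<and> (\<forall>y. h x + ereal (v \<bullet> (y - x)) \<le> h y)}"

definition indicator_fun :: "'a set \<Rightarrow> 'a \<Rightarrow> ereal"
  where "indicator_fun C x = (if x \<in> C then 0 else \<infinity>)"

definition composite :: "('a \<Rightarrow> real) \<Rightarrow> ('a \<Rightarrow> ereal) \<Rightarrow> 'a \<Rightarrow> ereal"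
  where "composite h\<^sub>1 h\<^sub>2 x = ereal (h\<^sub>1 x) + h\<^sub>2 x"

definition argmin_set :: "('a \<Rightarrow> ereal) \<Rightarrow> 'a set"
  where "argmin_set g = {x. \<forall>y. g x \<le> g y}"

definition sbo_solutions :: "('a \<Rightarrow> ereal) \<Rightarrow> ('a \<Rightarrow> ereal) \<Rightarrow> 'a set"
  where "sbo_solutions f g = {x \<in> argmin_set g. \<forall>y\<in>argmin_set g. f x \<le> f y}"

definition sbo_value :: "('a \<Rightarrow> ereal) \<Rightarrow> ('a \<Rightarrow> ereal) \<Rightarrow> ereal"
  where "sbo_value f g = (INF x\<in>argmin_set g. f x)"

text \<open>The minima of the theory (optimal values, the value function \<open>min {g x | f x \<le> c}\<close>) are rendered
  as infima in \<^typ>\<open>ereal\<close>.\<close>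

definition level_value :: "('a \<Rightarrow> ereal) \<Rightarrow> ('a \<Rightarrow> ereal) \<Rightarrow> real \<Rightarrow> ereal"
  where "level_value f g c = (INF x\<in>{x. f x \<le> ereal c}. g x)"

definition dual_value ::
  "('a \<Rightarrow> ereal) \<Rightarrow> ('a \<Rightarrow> ereal) \<Rightarrow> 'a set \<Rightarrow> real \<Rightarrow> real \<Rightarrow> ereal"
  where "dual_value f g X c z = (INF x\<in>X. g x + ereal z * (f x - ereal c))"

definition sbo_problem ::
  "('a::euclidean_space \<Rightarrow> real) \<Rightarrow> ('a \<Rightarrow> ereal) \<Rightarrow> ('a \<Rightarrow> real) \<Rightarrow> ('a \<Rightarrow> ereal) \<Rightarrow>
    real \<Rightarrow> real \<Rightarrow> bool"
  where "sbo_problem f\<^sub>1 f\<^sub>2 g\<^sub>1 g\<^sub>2 Lf Lg \<longleftrightarrow>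
    0 < Lf \<and> 1 \<le> Lg \<and>
    convex_on UNIV f\<^sub>1 \<and> lipschitz_gradient Lf f\<^sub>1 \<and>
    convex_on UNIV g\<^sub>1 \<and> lipschitz_gradient Lg g\<^sub>1 \<and>
    proper f\<^sub>2 \<and> lsc f\<^sub>2 \<and> convex_ereal f\<^sub>2 \<and>
    proper g\<^sub>2 \<and> lsc g\<^sub>2 \<and> convex_ereal g\<^sub>2 \<and>
    argmin_set (composite g\<^sub>1 g\<^sub>2) \<noteq> {} \<and>
    sbo_solutions (composite f\<^sub>1 f\<^sub>2) (composite g\<^sub>1 g\<^sub>2) \<noteq> {}"

definition assumption_A ::
  "('a::euclidean_space \<Rightarrow> real) \<Rightarrow> ('a \<Rightarrow> ereal) \<Rightarrow> ('a \<Rightarrow> real) \<Rightarrow> ('a \<Rightarrow> ereal) \<Rightarrow>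
    real \<Rightarrow> bool"
  where "assumption_A f\<^sub>1 f\<^sub>2 g\<^sub>1 g\<^sub>2 l \<longleftrightarrow>
    continuous_on (edom g\<^sub>2) g\<^sub>2 \<and>
    edom g\<^sub>2 \<noteq> {} \<and> compact (edom g\<^sub>2) \<and> convex (edom g\<^sub>2) \<and>
    edom g\<^sub>2 \<subseteq> edom f\<^sub>2 \<and>
    l-lipschitz_on (edom g\<^sub>2) (\<lambda>x. real_of_ereal (f\<^sub>2 x)) \<and>
    sbo_value (composite f\<^sub>1 f\<^sub>2) (composite g\<^sub>1 g\<^sub>2) > (INF x\<in>edom g\<^sub>2. composite f\<^sub>1 f\<^sub>2 x)"

definition reference_certificate ::
  "('a \<Rightarrow> real) \<Rightarrow> ('a \<Rightarrow> ereal) \<Rightarrow> ('a \<Rightarrow> real) \<Rightarrow> ('a \<Rightarrow> ereal) \<Rightarrow>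
    real \<Rightarrow> real \<Rightarrow> 'a \<Rightarrow> real \<Rightarrow> bool"
  where "reference_certificate f\<^sub>1 f\<^sub>2 g\<^sub>1 g\<^sub>2 l\<^sub>0 \<Delta> x\<^sub>f M \<longleftrightarrow>
    (let f = composite f\<^sub>1 f\<^sub>2; g = composite g\<^sub>1 g\<^sub>2 in
      x\<^sub>f \<in> edom g\<^sub>2 \<and>
      (INF x\<in>edom g\<^sub>2. f x) < ereal l\<^sub>0 \<and> ereal l\<^sub>0 < sbo_value f g \<and>
      ereal l\<^sub>0 = f x\<^sub>f + ereal \<Delta> \<and> 0 < \<Delta> \<and>
      (\<exists>x\<^sub>r\<in>edom g\<^sub>2. g x\<^sub>r - (INF x\<in>edom g\<^sub>2. g x) \<le> 1 \<and>
        ereal M = max ((g x\<^sub>f - g x\<^sub>r + 1) / ereal \<Delta>) 1))"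

text \<open>\<open>Value h y\<close>, \<open>Gradient h y\<close> and \<open>Prox \<tau> h y\<close> record one evaluation of \<open>h\<close>, of the gradient of
  \<open>h\<close>, and of the proximal operator of \<open>\<tau> h\<close>, respectively, at the point \<open>y\<close>. A run of an algorithm
  is described by its output together with the list of the operations it has performed.\<close>

datatype 'a operation =
    Value "'a \<Rightarrow> ereal" 'a
  | Gradient "'a \<Rightarrow> real" 'a
  | Prox real "'a \<Rightarrow> ereal" 'a

definition basic_operations ::
  "('a \<Rightarrow> real) \<Rightarrow> ('a \<Rightarrow> ereal) \<Rightarrow> ('a \<Rightarrow> real) \<Rightarrow> ('a \<Rightarrow> ereal) \<Rightarrow> 'a operation set"
  where "basic_operations f\<^sub>1 f\<^sub>2 g\<^sub>1 g\<^sub>2 =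
    {Value h y | h y. h \<in> {\<lambda>x. ereal (f\<^sub>1 x), f\<^sub>2, \<lambda>x. ereal (g\<^sub>1 x), g\<^sub>2}} \<union>
    {Gradient h y | h y. h \<in> {f\<^sub>1, g\<^sub>1}} \<union>
    {Prox \<tau> (\<lambda>x. g\<^sub>2 x + ereal \<theta> * f\<^sub>2 x) y | \<tau> \<theta> y. 0 < \<tau> \<and> 0 \<le> \<theta>} \<union>
    {Prox \<tau> (\<lambda>x. f\<^sub>2 x + indicator_fun (edom g\<^sub>2) x) y | \<tau> y. 0 < \<tau>}"

text \<open>A call \<open>apg \<mu> \<phi>\<^sub>1 \<phi>\<^sub>2 \<delta> x\<close> returns a point and the list of proximal-gradient operations
  performed, each given as the list of the operations it consists of.\<close>

type_synonym 'a apg =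
  "real \<Rightarrow> ('a \<Rightarrow> real) \<Rightarrow> ('a \<Rightarrow> ereal) \<Rightarrow> real \<Rightarrow> 'a \<Rightarrow> 'a \<times> 'a operation list list"

definition apg_admissible ::
  "real \<Rightarrow> ('a::euclidean_space \<Rightarrow> real) \<Rightarrow> ('a \<Rightarrow> ereal) \<Rightarrow> real \<Rightarrow> 'a \<Rightarrow> real \<Rightarrow> real \<Rightarrow> bool"
  where "apg_admissible \<mu> \<phi>\<^sub>1 \<phi>\<^sub>2 \<delta> x L D \<longleftrightarrow>
    0 < \<mu> \<and> strongly_convex \<mu> \<phi>\<^sub>1 \<and> lipschitz_gradient L \<phi>\<^sub>1 \<and>
    proper \<phi>\<^sub>2 \<and> lsc \<phi>\<^sub>2 \<and> convex_ereal \<phi>\<^sub>2 \<and>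
    bounded (edom \<phi>\<^sub>2) \<and> diameter (edom \<phi>\<^sub>2) \<le> D \<and>
    0 < \<delta> \<and> x \<in> edom \<phi>\<^sub>2"

text \<open>The gradient and the values of such a function are available through those of \<open>f\<^sub>1\<close> and \<open>g\<^sub>1\<close>.\<close>

definition oracle_smooth ::
  "('a::euclidean_space \<Rightarrow> real) \<Rightarrow> ('a \<Rightarrow> real) \<Rightarrow> ('a \<Rightarrow> real) \<Rightarrow> bool"
  where "oracle_smooth f\<^sub>1 g\<^sub>1 \<phi>\<^sub>1 \<longleftrightarrow>
    (\<exists>a\<ge>0. \<exists>b\<ge>0. \<exists>q\<ge>0. \<exists>u r.
      \<phi>\<^sub>1 = (\<lambda>x. a * g\<^sub>1 x + b * f\<^sub>1 x + q / 2 * (norm (x - u))\<^sup>2 + r))"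

definition oracle_prox ::
  "('a \<Rightarrow> real) \<Rightarrow> ('a \<Rightarrow> ereal) \<Rightarrow> ('a \<Rightarrow> real) \<Rightarrow> ('a \<Rightarrow> ereal) \<Rightarrow> ('a \<Rightarrow> ereal) \<Rightarrow> bool"
  where "oracle_prox f\<^sub>1 f\<^sub>2 g\<^sub>1 g\<^sub>2 \<phi>\<^sub>2 \<longleftrightarrow>
    (\<forall>\<tau>>0. \<forall>y. Prox \<tau> \<phi>\<^sub>2 y \<in> basic_operations f\<^sub>1 f\<^sub>2 g\<^sub>1 g\<^sub>2)"

text \<open>\<open>\<kappa>\<close> is the constant hidden in the number of proximal-gradient operations, and \<open>\<nu>\<close> bounds the
  number of basic operations each of them uses. The bound on basic operations only makes sense, and
  is only required, for objectives accessible through the oracles of the bilevel problem.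
  The distance of \<open>0\<close> to the empty set is \<open>\<infinity>\<close>, whereas \<^const>\<open>infdist\<close> gives \<open>0\<close>, so nonemptiness
  of the subdifferential is a separate requirement.\<close>

definition apg_black_box ::
  "('a::euclidean_space \<Rightarrow> real) \<Rightarrow> ('a \<Rightarrow> ereal) \<Rightarrow> ('a \<Rightarrow> real) \<Rightarrow> ('a \<Rightarrow> ereal) \<Rightarrow>
    real \<Rightarrow> nat \<Rightarrow> 'a apg \<Rightarrow> bool"
  where "apg_black_box f\<^sub>1 f\<^sub>2 g\<^sub>1 g\<^sub>2 \<kappa> \<nu> apg \<longleftrightarrow>
    (\<forall>\<mu> \<phi>\<^sub>1 \<phi>\<^sub>2 \<delta> x L D. apg_admissible \<mu> \<phi>\<^sub>1 \<phi>\<^sub>2 \<delta> x L D \<longrightarrow>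
      (case apg \<mu> \<phi>\<^sub>1 \<phi>\<^sub>2 \<delta> x of (y, steps) \<Rightarrow>
        y \<in> edom \<phi>\<^sub>2 \<and>
        subdifferential (composite \<phi>\<^sub>1 \<phi>\<^sub>2) y \<noteq> {} \<and>
        infdist 0 (subdifferential (composite \<phi>\<^sub>1 \<phi>\<^sub>2) y) \<le> \<delta> \<and>
        real (length steps) \<le> \<kappa> * (sqrt (L / \<mu>) * (1 + real (nat \<lceil>log 2 (L * D / \<delta>)\<rceil>))) \<and>
        (oracle_smooth f\<^sub>1 g\<^sub>1 \<phi>\<^sub>1 \<and> oracle_prox f\<^sub>1 f\<^sub>2 g\<^sub>1 g\<^sub>2 \<phi>\<^sub>2 \<longrightarrow>
          (\<forall>s\<in>set steps. set s \<subseteq> basic_operations f\<^sub>1 f\<^sub>2 g\<^sub>1 g\<^sub>2 \<and> length s \<le> \<nu>))))"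

text \<open>The argument \<open>A\<close> maps a multiplier to the computed point and the operations spent on it, the
  evaluation of \<open>\<psi>\<close> at that point included; \<open>tr\<close> accumulates the operations performed so far. The
  result is \<^const>\<open>None\<close> if and only if the loop does not terminate.\<close>

partial_function (option) interval_search ::
  "('a \<Rightarrow> ereal) \<Rightarrow> (real \<Rightarrow> 'a \<times> 'a operation list) \<Rightarrow> real \<Rightarrow> real \<Rightarrow>
    real \<Rightarrow> real \<Rightarrow> 'a \<Rightarrow> 'a \<Rightarrow> 'a operation list \<Rightarrow>
    (real \<times> real \<times> 'a \<times> 'a \<times> 'a operation list) option"
  where "interval_search \<psi> A \<epsilon>\<^sub>2 M a b x\<^sub>a x\<^sub>b tr =
    (if max (\<psi> x\<^sub>b) 0 > ereal \<epsilon>\<^sub>2 \<and> b < M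
     then (let (x, ops) = A (2 * b)
           in interval_search \<psi> A \<epsilon>\<^sub>2 M b (2 * b) x\<^sub>b x (tr @ ops))
     else Some (a, b, x\<^sub>a, x\<^sub>b, tr))"

partial_function (option) bisection ::
  "('a \<Rightarrow> ereal) \<Rightarrow> (real \<Rightarrow> 'a \<times> 'a operation list) \<Rightarrow> real \<Rightarrow> real \<Rightarrow> real \<Rightarrow>
    real \<Rightarrow> real \<Rightarrow> 'a \<Rightarrow> 'a \<Rightarrow> 'a operation list \<Rightarrow>
    (('a \<times> real) \<times> 'a operation list) option"
  where "bisection \<psi> A \<epsilon>\<^sub>2 \<epsilon>\<^sub>3 tol a b x\<^sub>a x\<^sub>b tr =
    (if b - a > tol
     then (let z = (a + b) / 2; (x, ops) = A z in
           if max (\<psi> x) 0 > ereal \<epsilon>\<^sub>2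
           then bisection \<psi> A \<epsilon>\<^sub>2 \<epsilon>\<^sub>3 tol z b x x\<^sub>b (tr @ ops)
           else if \<bar>ereal z * \<psi> x\<bar> \<le> ereal \<epsilon>\<^sub>3 then Some ((x, z), tr @ ops)
           else bisection \<psi> A \<epsilon>\<^sub>2 \<epsilon>\<^sub>3 tol a z x\<^sub>a x (tr @ ops))
     else Some ((x\<^sub>b, b), tr))"

text \<open>\<open>ev x\<close> lists the basic operations which evaluate \<open>\<psi> = \<psi>\<^sub>1 + \<psi>\<^sub>2\<close> at \<open>x\<close>; they are charged once
  for each point computed.\<close>

definition Dual ::
  "'a apg \<Rightarrow> ('a \<Rightarrow> 'a operation list) \<Rightarrow>
    ('a \<Rightarrow> real) \<Rightarrow> ('a \<Rightarrow> ereal) \<Rightarrow> real \<Rightarrow> ('a \<Rightarrow> real) \<Rightarrow> ('a \<Rightarrow> ereal) \<Rightarrow>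
    real \<Rightarrow> real \<Rightarrow> 'a \<Rightarrow> real \<Rightarrow> (('a \<times> real) \<times> 'a operation list) option"
  where "Dual apg ev \<phi>\<^sub>1 \<phi>\<^sub>2 \<mu> \<psi>\<^sub>1 \<psi>\<^sub>2 \<sigma> M x\<^sub>i\<^sub>n \<delta> =
    (let \<epsilon>\<^sub>1 = \<mu> * \<delta>\<^sup>2; \<epsilon>\<^sub>2 = \<delta>; \<epsilon>\<^sub>3 = 4 * M * \<delta>;
         \<psi> = composite \<psi>\<^sub>1 \<psi>\<^sub>2;
         A = (\<lambda>z. let (x, steps) =
                   apg \<mu> (\<lambda>x. \<phi>\<^sub>1 x + z * \<psi>\<^sub>1 x) (\<lambda>x. \<phi>\<^sub>2 x + ereal z * \<psi>\<^sub>2 x) \<epsilon>\<^sub>1 x\<^sub>i\<^sub>n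
                 in (x, concat steps @ ev x));
         (x\<^sub>0, ops\<^sub>0) = A 0
     in if max (\<psi> x\<^sub>0) 0 \<le> ereal \<epsilon>\<^sub>2 then Some ((x\<^sub>0, 0), ops\<^sub>0)
        else let (x\<^sub>\<sigma>, ops\<^sub>\<sigma>) = A \<sigma> in
          Option.bind (interval_search \<psi> A \<epsilon>\<^sub>2 M 0 \<sigma> x\<^sub>0 x\<^sub>\<sigma> (ops\<^sub>0 @ ops\<^sub>\<sigma>))
            (\<lambda>(a, b, x\<^sub>a, x\<^sub>b, tr).
              if \<bar>ereal b * \<psi> x\<^sub>b\<bar> \<le> ereal \<epsilon>\<^sub>3 then Some ((x\<^sub>b, b), tr)
              else bisection \<psi> A \<epsilon>\<^sub>2 \<epsilon>\<^sub>3 (\<mu> * \<delta> ^ 3) a b x\<^sub>a x\<^sub>b tr))"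

definition C_D :: "real \<Rightarrow> real"
  where "C_D D = 1 + D * (1 + D)"

definition C_\<Delta> :: "real \<Rightarrow> real \<Rightarrow> real"
  where "C_\<Delta> D M = 4 * C_D D * M"

definition VTest ::
  "'a::euclidean_space apg \<Rightarrow>
    ('a \<Rightarrow> real) \<Rightarrow> ('a \<Rightarrow> ereal) \<Rightarrow> ('a \<Rightarrow> real) \<Rightarrow> ('a \<Rightarrow> ereal) \<Rightarrow>
    real \<Rightarrow> 'a \<Rightarrow> real \<Rightarrow> real \<Rightarrow> real \<Rightarrow> 'a \<Rightarrow> (('a \<times> real) \<times> 'a operation list) option"
  where "VTest apg f\<^sub>1 f\<^sub>2 g\<^sub>1 g\<^sub>2 D x\<^sub>f M c \<delta> x\<^sub>i\<^sub>n =
    (let \<eta> = \<delta> / C_D D in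
      Dual apg (\<lambda>x. [Value (\<lambda>y. ereal (f\<^sub>1 y)) x, Value f\<^sub>2 x])
        (\<lambda>x. g\<^sub>1 x + \<eta> / 2 * (norm (x - x\<^sub>f))\<^sup>2) g\<^sub>2 \<eta>
        (\<lambda>x. f\<^sub>1 x - c) f\<^sub>2 1 M x\<^sub>i\<^sub>n (\<delta> / C_\<Delta> D M))"

end

theory Submission
  imports Defs
begin

text \<open>
  Write \<open>X\<close> for the domain of \<open>g\<^sub>2\<close>, \<open>\<eta> = \<delta> / C\<^sub>D\<close> for the regularisation parameter and \<open>\<rho> = \<eta> / (4 M)\<close>
  for the accuracy of the dual search. The call solves approximately, for varying multipliers
  \<open>z \<ge> 0\<close>, the subproblem of minimising the Lagrangian \<open>g + z (f - c) + \<eta>/2 \<parallel>\<cdot> - x\<^sub>f\<parallel>\<^sup>2\<close> over \<open>X\<close>, each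
  up to a subgradient of norm at most \<open>\<eta> \<rho>\<^sup>2\<close>. The returned pair satisfies
  \<open>f x - c \<le> \<rho>\<close> and \<open>\<bar>z (f x - c)\<bar> \<le> \<eta>\<close>; this and near-optimality give the accuracy claims. Near-complementarity
  and near-optimality give \<open>g x \<le> d\<^sub>c z + \<delta>\<close>, because \<open>C\<^sub>D\<close> absorbs the regularisation and the
  solver error (\<open>near_min_dual_gap\<close>), and \<open>d\<^sub>c z\<close> is at most the level value by weak duality.
  Conversely, shifting \<open>x\<close> slightly towards the Slater point \<open>x\<^sub>f\<close> makes it feasible at a cost of at most
  \<open>M \<rho>\<close> in \<open>g\<close> (\<open>feasible_point_nearby\<close>), since \<open>M \<Delta>\<close> bounds the excess of \<open>g x\<^sub>f\<close> over the minimum.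

  Two facts make the search end with such a pair. From multiplier \<open>M\<close> on, comparison with \<open>x\<^sub>f\<close> shows
  that approximate minimisers satisfy \<open>f x - c \<le> \<rho>\<close> (\<open>near_min_large_multiplier\<close>), so the doubling
  phase stops below \<open>2 M\<close> with a right endpoint of this kind. In a bracket that the bisection still
  considers, \<open>f - c\<close> exceeds \<open>\<rho>\<close> at the left point and lies below \<open>- 2 \<rho>\<close> at the right one, while
  strong convexity makes approximate minimisers move by at most \<open>(b - a) B / \<eta> + 2 \<rho>\<^sup>2\<close>
  between multipliers \<open>a < b\<close>; hence \<open>b - a\<close> stays above the tolerance \<open>\<eta> \<rho>\<^sup>3\<close> (\<open>near_min_separation\<close>)
  and the loop can only end by accepting a midpoint.

  For the complexity, the number of solver calls is logarithmic in \<open>M\<close> and \<open>M / (\<eta> \<rho>\<^sup>3)\<close>, and each call costs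
  \<open>\<surd>(L / \<eta>)\<close> times a logarithm of \<open>L D / (\<eta> \<rho>\<^sup>2)\<close>. The arguments of all these logarithms are at most a
  fixed power of \<open>2 + L\<^sub>f + L\<^sub>g + D + M\<close> divided by a fixed power of \<open>\<delta>\<close> (\<open>complexity_arithmetic\<close>).
\<close>

section \<open>Nonnegative combinations of extended-valued convex functions\<close>

lemma edom_add_scaled:
  assumes "proper g" "proper f" "edom g \<subseteq> edom f" "0 \<le> z"
  shows "edom (\<lambda>x. g x + ereal z * f x) = edom g"
proof -
  have "g x + ereal z * f x < \<infinity> \<longleftrightarrow> g x < \<infinity>" for x
  proof -
    have 1: "g x \<noteq> -\<infinity>" "f x \<noteq> -\<infinity>" "g x < \<infinity> \<Longrightarrow> f x < \<infinity>"
      using assms unfolding proper_def edom_def by auto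
    show ?thesis
      using 1 \<open>0 \<le> z\<close> by (cases "g x"; cases "f x") (auto simp: zero_ereal_def)
  qed
  then show ?thesis unfolding edom_def by auto
qed

lemma scaled_neq_minf:
  fixes a :: ereal
  assumes "a \<noteq> -\<infinity>" "0 \<le> z"
  shows "ereal z * a \<noteq> -\<infinity>"
  using assms by (cases a) (auto simp: zero_ereal_def)

lemma proper_add_scaled:
  assumes "proper g" "proper f" "edom g \<subseteq> edom f" "0 \<le> z"
  shows "proper (\<lambda>x. g x + ereal z * f x)"
  using edom_add_scaled[OF assms] assms scaled_neq_minf[OF _ \<open>0 \<le> z\<close>]
  unfolding proper_def by simp

lemma lsc_add:
  fixes h k :: "'a::topological_space \<Rightarrow> ereal"
  assumes "lsc h" "lsc k" "\<And>x. h x \<noteq> -\<infinity>" "\<And>x. k x \<noteq> -\<infinity>"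
  shows "lsc (\<lambda>x. h x + k x)"
  unfolding lsc_def le_Liminf_iff
proof (intro allI impI)
  fix x y assume "y < h x + k x"
  then obtain r where r: "y < ereal r" "ereal r < h x + k x" using ereal_dense2 by blast
  have "\<exists>s. ereal s < h x \<and> ereal (r - s) < k x"
  proof (cases "h x" "k x" rule: ereal2_cases)
    case (real_real a b)
    then show ?thesis using r(2) by (intro exI[of _ "a - (a + b - r) / 2"]) (auto simp: field_simps)
  next
    case (real_PInf a)
    then show ?thesis by (intro exI[of _ "a - 1"]) auto
  next
    case (PInf_real b)
    then show ?thesis by (intro exI[of _ "r - b + 1"]) auto
  qed (use assms in auto)
  then obtain s where s: "ereal s < h x" "ereal (r - s) < k x" by blast
  have "eventually (\<lambda>w. ereal s < h w) (at x)" "eventually (\<lambda>w. ereal (r - s) < k w) (at x)"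
    using assms(1,2) s unfolding lsc_def le_Liminf_iff by blast+
  then show "eventually (\<lambda>w. y < h w + k w) (at x)"
  proof eventually_elim
    case (elim w)
    have "ereal s + ereal (r - s) \<le> h w + k w"
      using elim by (intro add_mono) auto
    then show ?case using r(1) by (simp add: less_le_trans)
  qed
qed

lemma lsc_scaled:
  fixes h :: "'a::euclidean_space \<Rightarrow> ereal"
  assumes "lsc h" "0 \<le> z"
  shows "lsc (\<lambda>x. ereal z * h x)"
  using assms unfolding lsc_def
  by (simp add: Liminf_ereal_mult_left ereal_mult_left_mono)

lemma convex_ereal_add_scaled:
  fixes g f :: "'a::real_vector \<Rightarrow> ereal"
  assumes "convex_ereal g" "convex_ereal f" "0 \<le> z"
  shows "convex_ereal (\<lambda>x. g x + ereal z * f x)"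
  unfolding convex_ereal_def
proof (intro allI impI)
  fix x y :: 'a and u v :: real
  assume uv: "0 \<le> u" "0 \<le> v" "u + v = 1"
  have 1: "g (u *\<^sub>R x + v *\<^sub>R y) \<le> ereal u * g x + ereal v * g y"
    and 2: "f (u *\<^sub>R x + v *\<^sub>R y) \<le> ereal u * f x + ereal v * f y"
    using assms(1,2) uv unfolding convex_ereal_def by blast+
  have "g (u *\<^sub>R x + v *\<^sub>R y) + ereal z * f (u *\<^sub>R x + v *\<^sub>R y)
      \<le> (ereal u * g x + ereal v * g y) + ereal z * (ereal u * f x + ereal v * f y)"
    using 1 2 \<open>0 \<le> z\<close> by (intro add_mono ereal_mult_left_mono) auto
  also have "\<dots> = ereal u * (g x + ereal z * f x) + ereal v * (g y + ereal z * f y)"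
    using uv \<open>0 \<le> z\<close> by (simp add: ereal_pos_distrib mult.left_commute add_ac)
  finally show "g (u *\<^sub>R x + v *\<^sub>R y) + ereal z * f (u *\<^sub>R x + v *\<^sub>R y)
      \<le> ereal u * (g x + ereal z * f x) + ereal v * (g y + ereal z * f y)" .
qed

lemma convex_on_real_part:
  assumes "convex_ereal h" "convex X" "\<And>x. x \<in> X \<Longrightarrow> \<bar>h x\<bar> \<noteq> \<infinity>"
  shows "convex_on X (\<lambda>x. real_of_ereal (h x))"
proof (rule convex_onI)
  fix t :: real and x y assume t: "0 < t" "t < 1" and xy: "x \<in> X" "y \<in> X"
  have w: "(1 - t) *\<^sub>R x + t *\<^sub>R y \<in> X"
    using assms(2) t xy by (simp add: convex_alt)
  have "h ((1 - t) *\<^sub>R x + t *\<^sub>R y) \<le> ereal (1 - t) * h x + ereal t * h y"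
    using assms(1)[unfolded convex_ereal_def, rule_format, of "1 - t" t x y] t by simp
  then show "real_of_ereal (h ((1 - t) *\<^sub>R x + t *\<^sub>R y))
      \<le> (1 - t) * real_of_ereal (h x) + t * real_of_ereal (h y)"
    using assms(3)[OF w] assms(3)[OF xy(1)] assms(3)[OF xy(2)]
    by (cases "h ((1 - t) *\<^sub>R x + t *\<^sub>R y)"; cases "h x"; cases "h y") auto
qed (rule assms(2))

section \<open>Quadratic regularisation\<close>

text \<open>Uses the exact identity for \<open>\<parallel>u x + v y - w\<parallel>\<^sup>2\<close>; so \<open>\<eta>\<close> may have any sign.\<close>

lemma strongly_convex_add_quadratic:
  fixes H :: "'a::real_inner \<Rightarrow> real"
  assumes "convex_on UNIV H"
  shows "strongly_convex \<eta> (\<lambda>x. H x + \<eta> / 2 * (norm (x - w))\<^sup>2)"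
  unfolding strongly_convex_def
proof (intro allI impI)
  fix x y :: 'a and u v :: real
  assume uv: "0 \<le> u" "0 \<le> v" "u + v = 1"
  have H: "H (u *\<^sub>R x + v *\<^sub>R y) \<le> u * H x + v * H y"
    using assms uv by (auto simp: convex_on_def)
  have v: "v = 1 - u" using uv by simp
  have eq: "u *\<^sub>R x + v *\<^sub>R y - w = u *\<^sub>R (x - w) + v *\<^sub>R (y - w)"
    unfolding v by (simp add: algebra_simps)
  have d: "x - y = (x - w) - (y - w)" by simp
  have Q: "(norm (u *\<^sub>R x + v *\<^sub>R y - w))\<^sup>2
      = u * (norm (x - w))\<^sup>2 + v * (norm (y - w))\<^sup>2 - u * v * (norm (x - y))\<^sup>2"
    unfolding eq d power2_norm_eq_inner unfolding v
    by (simp add: inner_add_left inner_add_right inner_diff_left inner_diff_right inner_commute algebra_simps)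
  show "H (u *\<^sub>R x + v *\<^sub>R y) + \<eta> / 2 * (norm (u *\<^sub>R x + v *\<^sub>R y - w))\<^sup>2
      \<le> u * (H x + \<eta> / 2 * (norm (x - w))\<^sup>2) + v * (H y + \<eta> / 2 * (norm (y - w))\<^sup>2)
          - \<eta> / 2 * u * v * (norm (x - y))\<^sup>2"
    unfolding Q using H by (simp add: algebra_simps)
qed

lemma lipschitz_gradient_add_quadratic:
  fixes g f :: "'a::real_inner \<Rightarrow> real"
  assumes "lipschitz_gradient Lg g" "lipschitz_gradient Lf f" "0 \<le> \<eta>" "0 \<le> z"
  shows "lipschitz_gradient (Lg + \<eta> + z * Lf)
    (\<lambda>x. g x + \<eta> / 2 * (norm (x - w))\<^sup>2 + z * (f x - c))"
proof -
  obtain a b where a: "\<And>x. GDERIV g x :> a x" "Lg-lipschitz_on UNIV a"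
    and b: "\<And>x. GDERIV f x :> b x" "Lf-lipschitz_on UNIV b"
    using assms unfolding lipschitz_gradient_def by blast
  have "GDERIV (\<lambda>x. g x + \<eta> / 2 * (norm (x - w))\<^sup>2 + z * (f x - c)) x
      :> a x + \<eta> *\<^sub>R (x - w) + z *\<^sub>R b x" for x
    using a(1)[of x] b(1)[of x] unfolding gderiv_def power2_norm_eq_inner
    by (auto intro!: derivative_eq_intros simp: inner_add_right inner_diff_right inner_diff_left inner_commute algebra_simps)
  moreover have "(Lg + \<eta> + z * Lf)-lipschitz_on UNIV (\<lambda>x. a x + \<eta> *\<^sub>R (x - w) + z *\<^sub>R b x)"
  proof (rule lipschitz_onI)
    fix x y
    have 1: "a x + \<eta> *\<^sub>R (x - w) + z *\<^sub>R b x - (a y + \<eta> *\<^sub>R (y - w) + z *\<^sub>R b y)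
      = (a x - a y) + \<eta> *\<^sub>R (x - y) + z *\<^sub>R (b x - b y)" by (simp add: algebra_simps)
    have 2: "norm (a x - a y) \<le> Lg * norm (x - y)" "norm (b x - b y) \<le> Lf * norm (x - y)"
      using lipschitz_on_normD[OF a(2)] lipschitz_on_normD[OF b(2)] by auto
    have "norm ((a x - a y) + \<eta> *\<^sub>R (x - y) + z *\<^sub>R (b x - b y))
      \<le> norm (a x - a y) + norm (\<eta> *\<^sub>R (x - y)) + norm (z *\<^sub>R (b x - b y))"
      by (meson add_right_mono norm_triangle_ineq order_trans)
    also have "\<dots> \<le> Lg * norm (x - y) + \<eta> * norm (x - y) + z * (Lf * norm (x - y))"
      using 2 assms(3,4) by (intro add_mono) (auto intro: mult_left_mono)
    finally show "dist (a x + \<eta> *\<^sub>R (x - w) + z *\<^sub>R b x) (a y + \<eta> *\<^sub>R (y - w) + z *\<^sub>R b y)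
      \<le> (Lg + \<eta> + z * Lf) * dist x y"
      unfolding dist_norm 1 by (simp add: algebra_simps)
  qed (use lipschitz_on_nonneg[OF a(2)] lipschitz_on_nonneg[OF b(2)] assms(3,4) in auto)
  ultimately show ?thesis unfolding lipschitz_gradient_def by (intro exI conjI allI)
qed

text \<open>A subgradient over \<open>X\<close> of a convex function plus \<open>\<eta>/2 \<parallel>\<cdot> - w\<parallel>\<^sup>2\<close> satisfies the stronger inequality
  expected of strong convexity. The subgradient inequality is applied along the segment from \<open>x\<close> to
  \<open>y\<close>, divided by the segment parameter \<open>t\<close>, and \<open>t\<close> is sent to \<open>0\<close>.\<close>

lemma strong_subgradient_inequality:
  fixes H :: "'a::real_inner \<Rightarrow> real"
  assumes H: "convex_on X H" and xy: "x \<in> X" "y \<in> X"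
    and sub: "\<And>y. y \<in> X \<Longrightarrow> H x + \<eta> / 2 * (norm (x - w))\<^sup>2 + v \<bullet> (y - x) \<le> H y + \<eta> / 2 * (norm (y - w))\<^sup>2"
  shows "H x + \<eta> / 2 * (norm (x - w))\<^sup>2 + v \<bullet> (y - x) + \<eta> / 2 * (norm (y - x))\<^sup>2
    \<le> H y + \<eta> / 2 * (norm (y - w))\<^sup>2"
proof -
  have expand: "(norm (x + t *\<^sub>R (y - x) - w))\<^sup>2
      = (norm (x - w))\<^sup>2 + 2 * t * ((y - x) \<bullet> (x - w)) + t\<^sup>2 * (norm (y - x))\<^sup>2" for t
  proof -
    have "x + t *\<^sub>R (y - x) - w = (x - w) + t *\<^sub>R (y - x)" by simp
    then show ?thesis unfolding power2_norm_eq_inner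
      by (simp only: inner_add_left inner_add_right inner_scaleR_left inner_scaleR_right)
        (simp add: inner_commute power2_eq_square algebra_simps)
  qed
  have ineq: "v \<bullet> (y - x) \<le> H y - H x + \<eta> * ((y - x) \<bullet> (x - w)) + t * (\<eta> / 2 * (norm (y - x))\<^sup>2)"
    if t: "0 < t" "t < 1" for t
  proof -
    have w: "x + t *\<^sub>R (y - x) = (1 - t) *\<^sub>R x + t *\<^sub>R y" by (simp add: algebra_simps)
    have "x + t *\<^sub>R (y - x) \<in> X"
      using H xy t unfolding w convex_on_def by (simp add: convex_alt)
    from sub[OF this] have "H x + t * (v \<bullet> (y - x)) \<le> H (x + t *\<^sub>R (y - x))
        + \<eta> / 2 * (2 * t * ((y - x) \<bullet> (x - w)) + t\<^sup>2 * (norm (y - x))\<^sup>2)"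
      unfolding expand by (simp add: algebra_simps)
    moreover have "H (x + t *\<^sub>R (y - x)) \<le> (1 - t) * H x + t * H y"
      unfolding w using convex_onD[OF H] xy t by simp
    ultimately have "t * (v \<bullet> (y - x))
        \<le> t * (H y - H x + \<eta> * ((y - x) \<bullet> (x - w)) + t * (\<eta> / 2 * (norm (y - x))\<^sup>2))"
      by (simp add: algebra_simps power2_eq_square)
    then show ?thesis using t by simp
  qed
  have "((\<lambda>t. H y - H x + \<eta> * ((y - x) \<bullet> (x - w)) + t * (\<eta> / 2 * (norm (y - x))\<^sup>2))
      \<longlongrightarrow> H y - H x + \<eta> * ((y - x) \<bullet> (x - w)) + 0 * (\<eta> / 2 * (norm (y - x))\<^sup>2)) (at_right (0::real))"
    by (intro tendsto_intros)
  moreover have "eventually (\<lambda>t. v \<bullet> (y - x) \<le> H y - H x + \<eta> * ((y - x) \<bullet> (x - w))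
      + t * (\<eta> / 2 * (norm (y - x))\<^sup>2)) (at_right (0::real))"
    using eventually_at_right_real[of 0 1] by (rule eventually_mono) (use ineq in auto)
  ultimately have lim: "v \<bullet> (y - x) \<le> H y - H x + \<eta> * ((y - x) \<bullet> (x - w))"
    using tendsto_lowerbound trivial_limit_at_right_real by fastforce
  have "(norm (y - w))\<^sup>2 = (norm (x - w))\<^sup>2 + 2 * ((y - x) \<bullet> (x - w)) + (norm (y - x))\<^sup>2"
    using expand[of 1] by simp
  then show ?thesis using lim by (simp add: ring_distribs)
qed

text \<open>Closedness makes the distance from \<open>0\<close> to a nonempty subdifferential attained.\<close>

lemma closed_subdifferential: "closed (subdifferential h x)"
proof (cases "\<bar>h x\<bar> = \<infinity>")
  case True then show ?thesis by (simp add: subdifferential_def)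
next
  case False
  then obtain r where r: "h x = ereal r" by auto
  have "subdifferential h x = (\<Inter>y. {v. ereal (r + v \<bullet> (y - x)) \<le> h y})"
    unfolding subdifferential_def using r by auto
  moreover have "closed {v. ereal (r + v \<bullet> (y - x)) \<le> h y}" for y
    by (intro closed_Collect_le continuous_intros continuous_on_ereal)
  ultimately show ?thesis by auto
qed

section \<open>Loops of the dual search\<close>

text \<open>Here and below \<open>P z x\<close> says that \<open>x\<close> is an acceptable answer of the solver at the multiplier \<open>z\<close>, \<open>W\<close>
  bounds the operations of one call, and only multipliers below \<open>2 M\<close> are ever used. The number \<open>n\<close> of
  doublings bounds the number of iterations.\<close>

lemma interval_search_terminates:
  fixes P :: "real \<Rightarrow> 'a \<Rightarrow> bool" and A :: "real \<Rightarrow> 'a \<times> 'a operation list"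
  assumes call: "\<And>z. 0 \<le> z \<Longrightarrow> z < 2 * M \<Longrightarrow>
      P z (fst (A z)) \<and> real (length (snd (A z))) \<le> W \<and> set (snd (A z)) \<subseteq> Ops"
    and large: "\<And>z x. M \<le> z \<Longrightarrow> z < 2 * M \<Longrightarrow> P z x \<Longrightarrow> max (\<psi> x) 0 \<le> ereal \<epsilon>\<^sub>2"
    and "0 \<le> W"
  shows "0 \<le> a \<Longrightarrow> a < b \<Longrightarrow> b < 2 * M \<Longrightarrow> b - a \<le> M \<Longrightarrow> P a x\<^sub>a \<Longrightarrow> P b x\<^sub>b \<Longrightarrow>
    max (\<psi> x\<^sub>a) 0 > ereal \<epsilon>\<^sub>2 \<Longrightarrow> set tr \<subseteq> Ops \<Longrightarrow> M \<le> 2 ^ n * b \<Longrightarrow>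
    \<exists>a' b' x\<^sub>a' x\<^sub>b' tr'.
      interval_search \<psi> A \<epsilon>\<^sub>2 M a b x\<^sub>a x\<^sub>b tr = Some (a', b', x\<^sub>a', x\<^sub>b', tr') \<and>
      0 \<le> a' \<and> a' < b' \<and> b' < 2 * M \<and> b' - a' \<le> M \<and> P a' x\<^sub>a' \<and> P b' x\<^sub>b' \<and>
      max (\<psi> x\<^sub>a') 0 > ereal \<epsilon>\<^sub>2 \<and> max (\<psi> x\<^sub>b') 0 \<le> ereal \<epsilon>\<^sub>2 \<and>
      set tr' \<subseteq> Ops \<and> real (length tr') \<le> real (length tr) + real n * W"
proof (induction n arbitrary: a b x\<^sub>a x\<^sub>b tr)
  case 0
  then have "max (\<psi> x\<^sub>b) 0 \<le> ereal \<epsilon>\<^sub>2" using large by simp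
  then show ?case
    using 0 by (subst interval_search.simps) (simp add: not_less)
next
  case (Suc n)
  show ?case
  proof (cases "max (\<psi> x\<^sub>b) 0 > ereal \<epsilon>\<^sub>2")
    case False
    then have "interval_search \<psi> A \<epsilon>\<^sub>2 M a b x\<^sub>a x\<^sub>b tr = Some (a, b, x\<^sub>a, x\<^sub>b, tr)"
      by (subst interval_search.simps) simp
    moreover have "0 \<le> real (Suc n) * W" using \<open>0 \<le> W\<close> by simp
    ultimately show ?thesis
      using Suc.prems False by (simp add: not_less)
  next
    case True
    have bM: "b < M" using large[of b x\<^sub>b] True Suc.prems by (metis not_le)
    obtain x ops where A: "A (2 * b) = (x, ops)" by fastforce
    have c: "P (2 * b) x" "real (length ops) \<le> W" "set ops \<subseteq> Ops"
      using call[of "2 * b"] A bM Suc.prems by auto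
    have "interval_search \<psi> A \<epsilon>\<^sub>2 M a b x\<^sub>a x\<^sub>b tr
        = interval_search \<psi> A \<epsilon>\<^sub>2 M b (2 * b) x\<^sub>b x (tr @ ops)"
      using True bM A by (subst interval_search.simps) simp
    moreover have "real (length (tr @ ops)) + real n * W \<le> real (length tr) + real (Suc n) * W"
      using c by (simp add: algebra_simps)
    moreover have "0 \<le> b" "b < 2 * b" "2 * b < 2 * M" "2 * b - b \<le> M" "M \<le> 2 ^ n * (2 * b)"
      "set (tr @ ops) \<subseteq> Ops"
      using Suc.prems bM c by auto
    ultimately show ?thesis
      using Suc.IH[of b "2 * b" x\<^sub>b x "tr @ ops"] Suc.prems(6) True c(1) by fastforce
  qed
qed

text \<open>By the separation hypothesis, a bracket whose left endpoint is infeasible and whose right endpoint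
  violates approximate complementarity is longer than the tolerance. Every bracket of the loop is of
  this kind, so the loop can only stop by accepting a midpoint.\<close>

lemma bisection_terminates:
  fixes P :: "real \<Rightarrow> 'a \<Rightarrow> bool" and A :: "real \<Rightarrow> 'a \<times> 'a operation list"
  assumes call: "\<And>z. 0 \<le> z \<Longrightarrow> z < 2 * M \<Longrightarrow>
      P z (fst (A z)) \<and> real (length (snd (A z))) \<le> W \<and> set (snd (A z)) \<subseteq> Ops"
    and separation: "\<And>a b x y. 0 \<le> a \<Longrightarrow> a < b \<Longrightarrow> b < 2 * M \<Longrightarrow> P a x \<Longrightarrow> P b y \<Longrightarrow>
      max (\<psi> x) 0 > ereal \<epsilon>\<^sub>2 \<Longrightarrow> max (\<psi> y) 0 \<le> ereal \<epsilon>\<^sub>2 \<Longrightarrow> \<bar>ereal b * \<psi> y\<bar> > ereal \<epsilon>\<^sub>3 \<Longrightarrow>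
      tol < b - a"
    and "0 \<le> W"
  shows "0 \<le> a \<Longrightarrow> a < b \<Longrightarrow> b < 2 * M \<Longrightarrow> P a x\<^sub>a \<Longrightarrow> P b x\<^sub>b \<Longrightarrow>
    max (\<psi> x\<^sub>a) 0 > ereal \<epsilon>\<^sub>2 \<Longrightarrow> max (\<psi> x\<^sub>b) 0 \<le> ereal \<epsilon>\<^sub>2 \<Longrightarrow> \<bar>ereal b * \<psi> x\<^sub>b\<bar> > ereal \<epsilon>\<^sub>3 \<Longrightarrow>
    set tr \<subseteq> Ops \<Longrightarrow> b - a \<le> 2 ^ n * tol \<Longrightarrow>
    \<exists>x z tr'. bisection \<psi> A \<epsilon>\<^sub>2 \<epsilon>\<^sub>3 tol a b x\<^sub>a x\<^sub>b tr = Some ((x, z), tr') \<and>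
      0 \<le> z \<and> z < 2 * M \<and> P z x \<and> max (\<psi> x) 0 \<le> ereal \<epsilon>\<^sub>2 \<and> \<bar>ereal z * \<psi> x\<bar> \<le> ereal \<epsilon>\<^sub>3 \<and>
      set tr' \<subseteq> Ops \<and> real (length tr') \<le> real (length tr) + real n * W"
proof (induction n arbitrary: a b x\<^sub>a x\<^sub>b tr)
  case 0
  then show ?case using separation[of a b x\<^sub>a x\<^sub>b] by simp
next
  case (Suc n)
  define z where "z = (a + b) / 2"
  obtain x ops where A: "A z = (x, ops)" by fastforce
  have z: "a < z" "z < b" "0 \<le> z" "z < 2 * M" "z - a \<le> 2 ^ n * tol" "b - z \<le> 2 ^ n * tol"
    using Suc.prems unfolding z_def by (auto simp: field_simps)
  have c: "P z x" "real (length ops) \<le> W" "set ops \<subseteq> Ops"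
    using call[of z] A z by auto
  have tol: "tol < b - a" using separation[of a b x\<^sub>a x\<^sub>b] Suc.prems by blast
  have tr: "set (tr @ ops) \<subseteq> Ops"
    "real (length (tr @ ops)) + real n * W \<le> real (length tr) + real (Suc n) * W"
    using c Suc.prems by (auto simp: algebra_simps)
  have step: "bisection \<psi> A \<epsilon>\<^sub>2 \<epsilon>\<^sub>3 tol a b x\<^sub>a x\<^sub>b tr =
      (if max (\<psi> x) 0 > ereal \<epsilon>\<^sub>2 then bisection \<psi> A \<epsilon>\<^sub>2 \<epsilon>\<^sub>3 tol z b x x\<^sub>b (tr @ ops)
       else if \<bar>ereal z * \<psi> x\<bar> \<le> ereal \<epsilon>\<^sub>3 then Some ((x, z), tr @ ops)
       else bisection \<psi> A \<epsilon>\<^sub>2 \<epsilon>\<^sub>3 tol a z x\<^sub>a x (tr @ ops))"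
    using tol A by (subst bisection.simps) (simp add: z_def[symmetric])
  consider "max (\<psi> x) 0 > ereal \<epsilon>\<^sub>2"
    | "max (\<psi> x) 0 \<le> ereal \<epsilon>\<^sub>2" "\<bar>ereal z * \<psi> x\<bar> \<le> ereal \<epsilon>\<^sub>3"
    | "max (\<psi> x) 0 \<le> ereal \<epsilon>\<^sub>2" "\<bar>ereal z * \<psi> x\<bar> > ereal \<epsilon>\<^sub>3"
    by (meson not_le)
  then show ?case
  proof cases
    case 1
    then have "bisection \<psi> A \<epsilon>\<^sub>2 \<epsilon>\<^sub>3 tol a b x\<^sub>a x\<^sub>b tr = bisection \<psi> A \<epsilon>\<^sub>2 \<epsilon>\<^sub>3 tol z b x x\<^sub>b (tr @ ops)"
      using step by simp
    with Suc.IH[of z b x x\<^sub>b "tr @ ops"] 1 z c tr Suc.prems show ?thesis by force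
  next
    case 2
    have "0 \<le> real n * W" using \<open>0 \<le> W\<close> by simp
    with 2 z c tr step show ?thesis by (auto simp: not_less[symmetric])
  next
    case 3
    then have "bisection \<psi> A \<epsilon>\<^sub>2 \<epsilon>\<^sub>3 tol a b x\<^sub>a x\<^sub>b tr = bisection \<psi> A \<epsilon>\<^sub>2 \<epsilon>\<^sub>3 tol a z x\<^sub>a x (tr @ ops)"
      using step by (simp add: not_less[symmetric])
    with Suc.IH[of a z x\<^sub>a x "tr @ ops"] 3 z c tr Suc.prems show ?thesis by force
  qed
qed

lemma le_two_power_log: "0 < y \<Longrightarrow> y \<le> 2 ^ nat \<lceil>log 2 y\<rceil>"
proof -
  assume y: "0 < y"
  have "y = 2 powr (log 2 y)" using y by simp
  also have "\<dots> \<le> 2 powr (real (nat \<lceil>log 2 y\<rceil>))" by (intro powr_mono real_nat_ceiling_ge) auto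
  finally show ?thesis by (simp add: powr_realpow)
qed

text \<open>Two calls precede the loops. The bracket handed to the bisection has length at most \<open>M\<close>, which
  gives the second logarithm.\<close>

lemma Dual_terminates:
  fixes apg :: "'a apg" and P :: "real \<Rightarrow> 'a \<Rightarrow> bool"
  assumes call: "\<And>z. 0 \<le> z \<Longrightarrow> z < 2 * M \<Longrightarrow>
      (case apg \<mu> (\<lambda>x. \<phi>\<^sub>1 x + z * \<psi>\<^sub>1 x) (\<lambda>x. \<phi>\<^sub>2 x + ereal z * \<psi>\<^sub>2 x) (\<mu> * \<delta>\<^sup>2) x\<^sub>i\<^sub>n of (x, steps) \<Rightarrow>
        P z x \<and> real (length (concat steps @ ev x)) \<le> W \<and> set (concat steps @ ev x) \<subseteq> Ops)"
    and large: "\<And>z x. M \<le> z \<Longrightarrow> z < 2 * M \<Longrightarrow> P z x \<Longrightarrow> max (composite \<psi>\<^sub>1 \<psi>\<^sub>2 x) 0 \<le> ereal \<delta>"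
    and separation: "\<And>a b x y. 0 \<le> a \<Longrightarrow> a < b \<Longrightarrow> b < 2 * M \<Longrightarrow> P a x \<Longrightarrow> P b y \<Longrightarrow>
      max (composite \<psi>\<^sub>1 \<psi>\<^sub>2 x) 0 > ereal \<delta> \<Longrightarrow> max (composite \<psi>\<^sub>1 \<psi>\<^sub>2 y) 0 \<le> ereal \<delta> \<Longrightarrow>
      \<bar>ereal b * composite \<psi>\<^sub>1 \<psi>\<^sub>2 y\<bar> > ereal (4 * M * \<delta>) \<Longrightarrow> \<mu> * \<delta> ^ 3 < b - a"
    and "0 \<le> W" "1 \<le> M" "0 < \<mu>" "0 < \<delta>"
  shows "\<exists>x z tr. Dual apg ev \<phi>\<^sub>1 \<phi>\<^sub>2 \<mu> \<psi>\<^sub>1 \<psi>\<^sub>2 1 M x\<^sub>i\<^sub>n \<delta> = Some ((x, z), tr) \<and>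
      0 \<le> z \<and> z < 2 * M \<and> P z x \<and> max (composite \<psi>\<^sub>1 \<psi>\<^sub>2 x) 0 \<le> ereal \<delta> \<and>
      \<bar>ereal z * composite \<psi>\<^sub>1 \<psi>\<^sub>2 x\<bar> \<le> ereal (4 * M * \<delta>) \<and> set tr \<subseteq> Ops \<and>
      real (length tr) \<le> real (2 + nat \<lceil>log 2 M\<rceil> + nat \<lceil>log 2 (M / (\<mu> * \<delta> ^ 3))\<rceil>) * W"
proof -
  define \<psi> where "\<psi> = composite \<psi>\<^sub>1 \<psi>\<^sub>2"
  define n m where "n = nat \<lceil>log 2 M\<rceil>" and "m = nat \<lceil>log 2 (M / (\<mu> * \<delta> ^ 3))\<rceil>"
  define A where "A z = (let (x, steps) =
      apg \<mu> (\<lambda>x. \<phi>\<^sub>1 x + z * \<psi>\<^sub>1 x) (\<lambda>x. \<phi>\<^sub>2 x + ereal z * \<psi>\<^sub>2 x) (\<mu> * \<delta>\<^sup>2) x\<^sub>i\<^sub>n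
      in (x, concat steps @ ev x))" for z
  have call': "P z (fst (A z)) \<and> real (length (snd (A z))) \<le> W \<and> set (snd (A z)) \<subseteq> Ops"
    if "0 \<le> z" "z < 2 * M" for z
    using call[OF that] unfolding A_def by (auto split: prod.splits)
  obtain x\<^sub>0 ops\<^sub>0 where A0: "A 0 = (x\<^sub>0, ops\<^sub>0)" by fastforce
  obtain x\<^sub>1 ops\<^sub>1 where A1: "A 1 = (x\<^sub>1, ops\<^sub>1)" by fastforce
  have c0: "P 0 x\<^sub>0" "real (length ops\<^sub>0) \<le> W" "set ops\<^sub>0 \<subseteq> Ops"
    and c1: "P 1 x\<^sub>1" "real (length ops\<^sub>1) \<le> W" "set ops\<^sub>1 \<subseteq> Ops"
    using call'[of 0] call'[of 1] A0 A1 \<open>1 \<le> M\<close> by auto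
  have W: "0 \<le> real n * W" "0 \<le> real m * W" using \<open>0 \<le> W\<close> by auto
  have D: "Dual apg ev \<phi>\<^sub>1 \<phi>\<^sub>2 \<mu> \<psi>\<^sub>1 \<psi>\<^sub>2 1 M x\<^sub>i\<^sub>n \<delta> =
     (if max (\<psi> x\<^sub>0) 0 \<le> ereal \<delta> then Some ((x\<^sub>0, 0), ops\<^sub>0)
      else Option.bind (interval_search \<psi> A \<delta> M 0 1 x\<^sub>0 x\<^sub>1 (ops\<^sub>0 @ ops\<^sub>1))
            (\<lambda>(a, b, x\<^sub>a, x\<^sub>b, tr).
              if \<bar>ereal b * \<psi> x\<^sub>b\<bar> \<le> ereal (4 * M * \<delta>) then Some ((x\<^sub>b, b), tr)
              else bisection \<psi> A \<delta> (4 * M * \<delta>) (\<mu> * \<delta> ^ 3) a b x\<^sub>a x\<^sub>b tr))"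
    unfolding Dual_def Let_def A_def[unfolded Let_def, symmetric] \<psi>_def[symmetric] A0 A1 by simp
  have "\<exists>x z tr. Dual apg ev \<phi>\<^sub>1 \<phi>\<^sub>2 \<mu> \<psi>\<^sub>1 \<psi>\<^sub>2 1 M x\<^sub>i\<^sub>n \<delta> = Some ((x, z), tr) \<and>
      0 \<le> z \<and> z < 2 * M \<and> P z x \<and> max (\<psi> x) 0 \<le> ereal \<delta> \<and>
      \<bar>ereal z * \<psi> x\<bar> \<le> ereal (4 * M * \<delta>) \<and> set tr \<subseteq> Ops \<and>
      real (length tr) \<le> real (2 + n + m) * W"
  proof (cases "max (\<psi> x\<^sub>0) 0 \<le> ereal \<delta>")
    case True
    have "real (length ops\<^sub>0) \<le> real (2 + n + m) * W"
    proof -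
      have "real (2 + n + m) * W = 2 * W + real n * W + real m * W" by (simp add: distrib_right)
      then show ?thesis using c0 W \<open>0 \<le> W\<close> by linarith
    qed
    with True show ?thesis
      unfolding D using c0 \<open>1 \<le> M\<close> \<open>0 < \<delta>\<close> by (simp add: zero_ereal_def[symmetric])
  next
    case False
    have "M \<le> 2 ^ n * 1" using le_two_power_log[of M] \<open>1 \<le> M\<close> unfolding n_def by simp
    moreover have "max (\<psi> x\<^sub>0) 0 > ereal \<delta>" using False by (simp only: not_le)
    moreover have "0 \<le> (0::real)" "0 < (1::real)" "1 < 2 * M" "1 - 0 \<le> M" "set (ops\<^sub>0 @ ops\<^sub>1) \<subseteq> Ops"
      using \<open>1 \<le> M\<close> c0 c1 by auto
    ultimately have "\<exists>a b x\<^sub>a x\<^sub>b tr.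
        interval_search \<psi> A \<delta> M 0 1 x\<^sub>0 x\<^sub>1 (ops\<^sub>0 @ ops\<^sub>1) = Some (a, b, x\<^sub>a, x\<^sub>b, tr) \<and>
        0 \<le> a \<and> a < b \<and> b < 2 * M \<and> b - a \<le> M \<and> P a x\<^sub>a \<and> P b x\<^sub>b \<and>
        max (\<psi> x\<^sub>a) 0 > ereal \<delta> \<and> max (\<psi> x\<^sub>b) 0 \<le> ereal \<delta> \<and>
        set tr \<subseteq> Ops \<and> real (length tr) \<le> real (length (ops\<^sub>0 @ ops\<^sub>1)) + real n * W"
      using \<open>0 \<le> W\<close> c0(1) c1(1)
      by (intro interval_search_terminates[where P = P, OF call' large[folded \<psi>_def]])
    then obtain a b x\<^sub>a x\<^sub>b tr where
      I: "interval_search \<psi> A \<delta> M 0 1 x\<^sub>0 x\<^sub>1 (ops\<^sub>0 @ ops\<^sub>1) = Some (a, b, x\<^sub>a, x\<^sub>b, tr)"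
      "0 \<le> a" "a < b" "b < 2 * M" "b - a \<le> M" "P a x\<^sub>a" "P b x\<^sub>b"
      "max (\<psi> x\<^sub>a) 0 > ereal \<delta>" "max (\<psi> x\<^sub>b) 0 \<le> ereal \<delta>"
      "set tr \<subseteq> Ops" "real (length tr) \<le> real (length (ops\<^sub>0 @ ops\<^sub>1)) + real n * W"
      by blast
    have len: "real (length tr) + real m * W \<le> real (2 + n + m) * W"
      using I(11) c0 c1 by (simp add: algebra_simps)
    show ?thesis
    proof (cases "\<bar>ereal b * \<psi> x\<^sub>b\<bar> \<le> ereal (4 * M * \<delta>)")
      case True
      with False I len W show ?thesis unfolding D by auto
    next
      case notacc: False
      have "0 < M / (\<mu> * \<delta> ^ 3)" using \<open>1 \<le> M\<close> \<open>0 < \<mu>\<close> \<open>0 < \<delta>\<close> by simp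
      from le_two_power_log[OF this] have "M \<le> 2 ^ m * (\<mu> * \<delta> ^ 3)"
        using \<open>0 < \<mu>\<close> \<open>0 < \<delta>\<close> unfolding m_def by (simp add: divide_le_eq)
      with I(5) have ba: "b - a \<le> 2 ^ m * (\<mu> * \<delta> ^ 3)" by simp
      have "\<exists>x z tr'. bisection \<psi> A \<delta> (4 * M * \<delta>) (\<mu> * \<delta> ^ 3) a b x\<^sub>a x\<^sub>b tr = Some ((x, z), tr') \<and>
          0 \<le> z \<and> z < 2 * M \<and> P z x \<and> max (\<psi> x) 0 \<le> ereal \<delta> \<and>
          \<bar>ereal z * \<psi> x\<bar> \<le> ereal (4 * M * \<delta>) \<and>
          set tr' \<subseteq> Ops \<and> real (length tr') \<le> real (length tr) + real m * W"
        using I notacc ba \<open>0 \<le> W\<close> unfolding not_le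
        by (intro bisection_terminates[where P = P, OF call' separation[folded \<psi>_def]])
      then obtain x z tr' where
        B: "bisection \<psi> A \<delta> (4 * M * \<delta>) (\<mu> * \<delta> ^ 3) a b x\<^sub>a x\<^sub>b tr = Some ((x, z), tr')"
          "0 \<le> z" "z < 2 * M" "P z x" "max (\<psi> x) 0 \<le> ereal \<delta>"
          "\<bar>ereal z * \<psi> x\<bar> \<le> ereal (4 * M * \<delta>)"
          "set tr' \<subseteq> Ops" "real (length tr') \<le> real (length tr) + real m * W"
        by blast
      have "Dual apg ev \<phi>\<^sub>1 \<phi>\<^sub>2 \<mu> \<psi>\<^sub>1 \<psi>\<^sub>2 1 M x\<^sub>i\<^sub>n \<delta> = Some ((x, z), tr')"
        unfolding D if_not_P[OF False] I(1) using notacc B(1) by simp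
      with B len show ?thesis by fastforce
    qed
  qed
  then show ?thesis unfolding \<psi>_def n_def m_def .
qed

section \<open>Approximate minimisers of the regularised Lagrangian\<close>

text \<open>The real-valued core of the argument: \<open>X\<close>, \<open>F\<close>, \<open>G\<close> stand for the domain of the lower-level
  objective and the restrictions of the two objectives to it. The hypothesis \<open>gap\<close> says
  that \<open>M\<close> is at least the classical bound of the optimal multipliers by a Slater point, here \<open>x\<^sub>f\<close>
  with slack \<open>\<Delta>\<close>.\<close>

locale slater_pair =
  fixes X :: "'a::real_inner set" and F G :: "'a \<Rightarrow> real" and x\<^sub>f :: 'a
    and D B M \<Delta> c \<delta> :: real
  assumes F: "convex_on X F" and G: "convex_on X G"
    and diam: "\<And>x y. x \<in> X \<Longrightarrow> y \<in> X \<Longrightarrow> norm (x - y) \<le> D"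
    and lip: "B-lipschitz_on X F"
    and x\<^sub>f: "x\<^sub>f \<in> X" and slack: "F x\<^sub>f + \<Delta> \<le> c" and \<Delta>: "0 < \<Delta>"
    and gap: "\<And>y. y \<in> X \<Longrightarrow> G x\<^sub>f - G y \<le> M * \<Delta>"
    and M: "1 \<le> M" and B: "1 \<le> B" and \<delta>: "0 < \<delta>" "\<delta> \<le> 1 / B"
begin

text \<open>The regularisation parameter.\<close>

definition \<eta> :: real where "\<eta> = \<delta> / C_D D"

text \<open>The accuracy passed to the dual search.\<close>

definition \<rho> :: real where "\<rho> = \<delta> / C_\<Delta> D M"

text \<open>The Lagrangian of minimising \<open>G\<close> subject to \<open>F \<le> c\<close>, regularised around \<open>x\<^sub>f\<close>.\<close>

definition lagrangian :: "real \<Rightarrow> 'a \<Rightarrow> real"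
  where "lagrangian z x = (G x + z * (F x - c)) + \<eta> / 2 * (norm (x - x\<^sub>f))\<^sup>2"

text \<open>Approximate minimisers over \<open>X\<close>: some subgradient \<open>v\<close> at \<open>x\<close> has norm at most \<open>\<eta> \<rho>\<^sup>2\<close>, the accuracy
  asked of the solver. The quadratic term, a consequence of strong convexity, is part of the
  definition; \<open>near_minI\<close> shows that it comes for free.\<close>

definition near_min :: "real \<Rightarrow> 'a \<Rightarrow> bool"
  where "near_min z x \<longleftrightarrow> x \<in> X \<and> (\<exists>v. norm v \<le> \<eta> * \<rho>\<^sup>2 \<and>
    (\<forall>y\<in>X. lagrangian z x + v \<bullet> (y - x) + \<eta> / 2 * (norm (y - x))\<^sup>2 \<le> lagrangian z y))"

lemma near_minI:
  assumes "x \<in> X" "norm v \<le> \<eta> * \<rho>\<^sup>2" "0 \<le> z"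
    and "\<And>y. y \<in> X \<Longrightarrow> lagrangian z x + v \<bullet> (y - x) \<le> lagrangian z y"
  shows "near_min z x"
proof -
  have H: "convex_on X (\<lambda>x. G x + z * (F x - c))"
  proof (rule convex_onI)
    show "convex X" using F by (simp add: convex_on_def)
    fix t :: real and x y assume t: "0 < t" "t < 1" and xy: "x \<in> X" "y \<in> X"
    have "z * F ((1 - t) *\<^sub>R x + t *\<^sub>R y) \<le> z * ((1 - t) * F x + t * F y)"
      using convex_onD[OF F, of t x y] t xy \<open>0 \<le> z\<close> by (intro mult_left_mono) auto
    moreover have "G ((1 - t) *\<^sub>R x + t *\<^sub>R y) \<le> (1 - t) * G x + t * G y"
      using convex_onD[OF G, of t x y] t xy by auto
    ultimately show "G ((1 - t) *\<^sub>R x + t *\<^sub>R y) + z * (F ((1 - t) *\<^sub>R x + t *\<^sub>R y) - c)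
        \<le> (1 - t) * (G x + z * (F x - c)) + t * (G y + z * (F y - c))"
      by (simp add: algebra_simps)
  qed
  have "lagrangian z x + v \<bullet> (y - x) + \<eta> / 2 * (norm (y - x))\<^sup>2 \<le> lagrangian z y" if "y \<in> X" for y
    using strong_subgradient_inequality[OF H assms(1) that, of \<eta> x\<^sub>f v] assms(4)
    unfolding lagrangian_def by simp
  then show ?thesis unfolding near_min_def using assms by blast
qed

lemma D_nonneg: "0 \<le> D"
  using diam[OF x\<^sub>f x\<^sub>f] by simp

lemma C_D_bounds: "1 \<le> C_D D" "D\<^sup>2 / 2 + D + 1 \<le> C_D D" "D \<le> C_D D"
  using D_nonneg by (auto simp: C_D_def power2_eq_square algebra_simps)

lemma constants: "\<delta> \<le> 1" "0 < \<eta>" "\<eta> \<le> 1" "\<eta> \<le> \<delta>" "0 < \<rho>" "4 * M * \<rho> = \<eta>" "B * \<rho> \<le> 1 / 4" "\<rho> \<le> 1 / 4" "D * \<rho> \<le> 1 / 4"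
proof -
  have Bd: "B * \<delta> \<le> 1" using \<delta> B by (simp add: field_simps)
  have "1 * \<delta> \<le> B * \<delta>" using B \<delta> by (intro mult_right_mono) auto
  with Bd show d1: "\<delta> \<le> 1" by simp
  have C: "1 \<le> C_D D" by (rule C_D_bounds)
  show eta: "0 < \<eta>" using C \<delta> by (simp add: \<eta>_def)
  show ed: "\<eta> \<le> \<delta>" using C \<delta> mult_right_mono[of 1 "C_D D" \<delta>] by (simp add: \<eta>_def divide_le_eq)
  with d1 show "\<eta> \<le> 1" by simp
  show rho: "0 < \<rho>" using C M \<delta> by (simp add: \<rho>_def C_\<Delta>_def)
  show M4: "4 * M * \<rho> = \<eta>" using C M by (simp add: \<rho>_def \<eta>_def C_\<Delta>_def field_simps)
  have r: "4 * \<rho> \<le> \<eta>" unfolding M4[symmetric] using M rho by simp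
  have "B * (4 * \<rho>) \<le> B * \<delta>" using r ed B by (intro mult_left_mono) auto
  with Bd show "B * \<rho> \<le> 1 / 4" by simp
  show "\<rho> \<le> 1 / 4" using r ed d1 by simp
  have "D * (4 * \<rho>) \<le> D * \<eta>" using r D_nonneg by (intro mult_left_mono)
  also have "\<dots> \<le> C_D D * \<eta>" using C_D_bounds(3) eta by (intro mult_right_mono) auto
  also have "\<dots> = \<delta>" using C by (simp add: \<eta>_def)
  finally show "D * \<rho> \<le> 1 / 4" using d1 by simp
qed

lemma inner_lower_bound:
  assumes "norm v \<le> \<eta> * \<rho>\<^sup>2"
  shows "- (\<eta> * \<rho>\<^sup>2 * norm w) \<le> v \<bullet> w"
proof -
  have "\<bar>v \<bullet> w\<bar> \<le> norm v * norm w" by (rule Cauchy_Schwarz_ineq2)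
  also have "\<dots> \<le> \<eta> * \<rho>\<^sup>2 * norm w" using assms by (intro mult_right_mono) auto
  finally show ?thesis by linarith
qed

lemma near_min_le:
  assumes "near_min z x" "y \<in> X"
  shows "lagrangian z x \<le> lagrangian z y + \<eta> * \<rho>\<^sup>2 * D"
proof -
  obtain v where v: "norm v \<le> \<eta> * \<rho>\<^sup>2"
    "lagrangian z x + v \<bullet> (y - x) + \<eta> / 2 * (norm (y - x))\<^sup>2 \<le> lagrangian z y"
    using assms unfolding near_min_def by blast
  have "\<eta> * \<rho>\<^sup>2 * norm (y - x) \<le> \<eta> * \<rho>\<^sup>2 * D"
    using diam assms constants unfolding near_min_def by (intro mult_left_mono) auto
  moreover have "0 \<le> \<eta> / 2 * (norm (y - x))\<^sup>2" using constants by simp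
  ultimately show ?thesis using v inner_lower_bound[OF v(1), of "y - x"] by linarith
qed

text \<open>For multipliers from \<open>M\<close> on, approximate minimisers are almost feasible. Comparing with \<open>x\<^sub>f\<close>, the gain
  \<open>z \<Delta>\<close> in the constraint term outweighs the loss of at most \<open>M \<Delta>\<close> in \<open>G\<close>.\<close>

lemma near_min_large_multiplier:
  assumes "near_min z x" "M \<le> z"
  shows "F x - c \<le> \<rho>"
proof -
  have x: "x \<in> X" using assms by (simp add: near_min_def)
  have "0 \<le> \<eta> / 2 * (norm (x - x\<^sub>f))\<^sup>2" using constants by simp
  then have "z * (F x - c) \<le> G x\<^sub>f - G x + z * (F x\<^sub>f - c) + \<eta> * \<rho>\<^sup>2 * D"
    using near_min_le[OF assms(1) x\<^sub>f] unfolding lagrangian_def by simp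
  also have "\<dots> \<le> M * \<Delta> + z * (- \<Delta>) + \<eta> * \<rho>\<^sup>2 * D"
    using gap[OF x] slack M assms(2) by (intro add_right_mono add_mono mult_left_mono) auto
  also have "\<dots> \<le> \<eta> * \<rho>\<^sup>2 * D"
    using mult_right_mono[OF assms(2), of \<Delta>] \<Delta> by simp
  also have "\<dots> = M * \<rho> * (4 * \<rho> * (D * \<rho>))"
    unfolding constants(6)[symmetric] by (simp add: power2_eq_square)
  also have "\<dots> \<le> M * \<rho> * 1"
    using constants M D_nonneg mult_mono[of "4 * \<rho>" 1 "D * \<rho>" 1]
    by (intro mult_left_mono) auto
  also have "\<dots> \<le> z * \<rho>" using assms(2) constants by simp
  finally show ?thesis using assms(2) M by simp
qed

text \<open>Up to the solver error \<open>2 \<rho>\<^sup>2\<close>, approximate minimisers are Lipschitz in the multiplier with constant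
  \<open>B / \<eta>\<close>, as one sees by adding the strong subgradient inequalities at two multipliers. So \<open>F\<close>
  cannot drop from above \<open>c + \<rho>\<close> to below \<open>c - 2 \<rho>\<close> within the bisection tolerance.\<close>

lemma near_min_separation:
  assumes "near_min a x" "near_min b y" "0 \<le> a" "a < b" "b < 2 * M"
    and "\<rho> < F x - c" "F y - c \<le> \<rho>" "4 * M * \<rho> < \<bar>b * (F y - c)\<bar>"
  shows "\<eta> * \<rho> ^ 3 < b - a"
proof (rule ccontr)
  assume "\<not> \<eta> * \<rho> ^ 3 < b - a"
  then have ba: "b - a \<le> \<eta> * \<rho> ^ 3" by simp
  note k = constants
  have y: "F y - c < - 2 * \<rho>"
  proof (rule ccontr)
    assume "\<not> F y - c < - 2 * \<rho>"
    then have "\<bar>F y - c\<bar> \<le> 2 * \<rho>" using assms k by auto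
    then have "b * \<bar>F y - c\<bar> \<le> 2 * M * (2 * \<rho>)" using assms by (intro mult_mono) auto
    then show False using assms by (simp add: abs_mult)
  qed
  have xy: "x \<in> X" "y \<in> X" using assms by (auto simp: near_min_def)
  define r where "r = norm (y - x)"
  obtain v where v: "norm v \<le> \<eta> * \<rho>\<^sup>2"
    "lagrangian a x + v \<bullet> (y - x) + \<eta> / 2 * r\<^sup>2 \<le> lagrangian a y"
    using assms(1) xy unfolding near_min_def r_def by blast
  obtain w where w: "norm w \<le> \<eta> * \<rho>\<^sup>2"
    "lagrangian b y + w \<bullet> (x - y) + \<eta> / 2 * r\<^sup>2 \<le> lagrangian b x"
    using assms(2) xy unfolding near_min_def r_def by (metis norm_minus_commute)
  have Fr: "F x - F y \<le> B * r"
    using lipschitz_on_normD[OF lip xy] unfolding r_def by (simp add: norm_minus_commute)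
  have "0 < B * r" using Fr y assms k by linarith
  then have r: "0 < r" using B by (simp add: zero_less_mult_iff)
  have "\<eta> * r\<^sup>2 - 2 * (\<eta> * \<rho>\<^sup>2 * r) \<le> (b - a) * (F x - F y)"
    using v w inner_lower_bound[OF v(1), of "y - x"] inner_lower_bound[OF w(1), of "x - y"]
    unfolding lagrangian_def r_def norm_minus_commute[of x y] by (simp add: algebra_simps)
  also have "\<dots> \<le> \<eta> * \<rho> ^ 3 * (B * r)"
    using ba Fr y assms k by (intro mult_mono) auto
  finally have "(\<eta> * r) * r \<le> (\<eta> * r) * (\<rho> ^ 3 * B + 2 * \<rho>\<^sup>2)"
    by (simp add: algebra_simps power2_eq_square)
  then have "r \<le> \<rho> ^ 3 * B + 2 * \<rho>\<^sup>2" using k r by simp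
  then have "B * r \<le> B * (\<rho> ^ 3 * B + 2 * \<rho>\<^sup>2)" using B by (intro mult_left_mono) auto
  also have "\<dots> = \<rho> * ((B * \<rho>) * (B * \<rho>) + 2 * (B * \<rho>))"
    by (simp add: algebra_simps power2_eq_square power3_eq_cube)
  also have "\<dots> \<le> \<rho> * (1 * 1 + 2 * 1)"
    using k B by (intro mult_left_mono add_mono mult_mono) auto
  finally show False using Fr y assms by simp
qed

text \<open>Consequently \<open>G x - \<delta>\<close> is a lower bound of the unregularised dual function at \<open>z\<close>. The loss \<open>\<delta>\<close> is made up
  of the regularisation, the solver error and the complementarity error: \<open>\<eta> (D\<^sup>2 / 2 + D + 1) \<le> \<eta> C\<^sub>D = \<delta>\<close>.\<close>

lemma near_min_dual_gap:
  assumes "near_min z x" "\<bar>z * (F x - c)\<bar> \<le> \<eta>" "y \<in> X"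
  shows "G x - \<delta> \<le> G y + z * (F y - c)"
proof -
  have "(norm (y - x\<^sub>f))\<^sup>2 \<le> D\<^sup>2" using diam[OF assms(3) x\<^sub>f] by (simp add: power_mono)
  then have 1: "\<eta> / 2 * (norm (y - x\<^sub>f))\<^sup>2 \<le> \<eta> / 2 * D\<^sup>2" using constants by (intro mult_left_mono) auto
  have 2: "0 \<le> \<eta> / 2 * (norm (x - x\<^sub>f))\<^sup>2" using constants by simp
  have "\<eta> * \<rho>\<^sup>2 * D \<le> \<eta> * 1 * D"
    using constants D_nonneg by (intro mult_right_mono mult_left_mono power_le_one) auto
  moreover have "\<eta> * (D\<^sup>2 / 2 + D + 1) = \<eta> / 2 * D\<^sup>2 + \<eta> * 1 * D + \<eta>" by (simp add: algebra_simps)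
  moreover have "- \<eta> \<le> z * (F x - c)" using assms(2) by linarith
  ultimately have "G x \<le> G y + z * (F y - c) + \<eta> * (D\<^sup>2 / 2 + D + 1)"
    using 1 2 near_min_le[OF assms(1,3)] unfolding lagrangian_def by linarith
  also have "\<eta> * (D\<^sup>2 / 2 + D + 1) \<le> \<eta> * C_D D"
    using C_D_bounds constants by (intro mult_left_mono) auto
  also have "\<dots> = \<delta>" using C_D_bounds by (simp add: \<eta>_def)
  finally show ?thesis by simp
qed

text \<open>A slightly infeasible point is moved towards \<open>x\<^sub>f\<close> until it is feasible.\<close>

lemma feasible_point_nearby:
  assumes "x \<in> X" "F x - c \<le> \<rho>"
  shows "\<exists>y\<in>X. F y \<le> c \<and> G y \<le> G x + \<delta>"
proof -
  \<comment> \<open>The weight at which the slack \<open>\<Delta>\<close> at \<open>x\<^sub>f\<close> exactly compensates a violation of \<open>\<rho>\<close>.\<close>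
  define t where "t = \<rho> / (\<rho> + \<Delta>)"
  have t: "0 \<le> t" "t \<le> 1" "(1 - t) * \<rho> = t * \<Delta>" "t * \<Delta> \<le> \<rho>"
    using constants \<Delta> unfolding t_def by (auto simp: field_simps)
  define y where "y = (1 - t) *\<^sub>R x + t *\<^sub>R x\<^sub>f"
  have "convex X" using F by (simp add: convex_on_def)
  then have "y \<in> X" unfolding y_def using assms(1) x\<^sub>f t by (simp add: convex_alt)
  moreover have "F y \<le> c"
  proof -
    have "F y \<le> (1 - t) * F x + t * F x\<^sub>f"
      unfolding y_def using convex_onD[OF F] t assms(1) x\<^sub>f by simp
    also have "\<dots> \<le> (1 - t) * (c + \<rho>) + t * (c - \<Delta>)"
      using t assms(2) slack by (intro add_mono mult_left_mono) auto
    also have "\<dots> = c" using t(3) by (simp add: algebra_simps)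
    finally show ?thesis .
  qed
  moreover have "G y \<le> G x + \<delta>"
  proof -
    have "G y \<le> (1 - t) * G x + t * G x\<^sub>f"
      unfolding y_def using convex_onD[OF G] t assms(1) x\<^sub>f by simp
    also have "\<dots> = G x + t * (G x\<^sub>f - G x)" by (simp add: algebra_simps)
    also have "\<dots> \<le> G x + t * (M * \<Delta>)"
      using gap[OF assms(1)] t by (intro add_mono mult_left_mono) auto
    also have "\<dots> \<le> G x + M * \<rho>" using mult_left_mono[OF t(4), of M] M by (simp add: algebra_simps)
    also have "\<dots> \<le> G x + \<delta>" using constants M by simp
    finally show ?thesis .
  qed
  ultimately show ?thesis by blast
qed

end

section \<open>Counting operations\<close>

lemma real_nat_ceiling_log_le:
  assumes y: "0 \<le> y" "y \<le> S ^ k / \<delta> ^ m" and S: "2 \<le> S" and \<delta>: "0 < \<delta>" "\<delta> \<le> (1::real)"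
  shows "real (nat \<lceil>log 2 y\<rceil>) \<le> (1 + 2 * real (k + m)) * ((1 + ln S) * (1 + ln (1 / \<delta>)))"
proof -
  define T where "T = (1 + ln S) * (1 + ln (1 / \<delta>))"
  have l: "0 \<le> ln S" "0 \<le> ln (1 / \<delta>)" using S \<delta> by auto
  then have T: "1 \<le> T" "ln S \<le> T" "ln (1 / \<delta>) \<le> T"
    unfolding T_def by (auto simp: algebra_simps add_increasing)
  have "log 2 y \<le> 2 * real (k + m) * T"
  proof (cases "y = 0")
    case True then show ?thesis using T by (simp add: log_def)
  next
    case False
    then have "ln y \<le> ln (S ^ k / \<delta> ^ m)" using y S \<delta> by simp
    also have "\<dots> = real k * ln S + real m * ln (1 / \<delta>)"
      using S \<delta> by (simp add: ln_div ln_realpow)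
    also have "\<dots> \<le> real k * T + real m * T" using T by (intro add_mono mult_left_mono) auto
    finally have ly: "ln y \<le> real (k + m) * T" by (simp add: algebra_simps)
    have "(1::real) / 2 \<le> ln 2" using ln2_ge_two_thirds by simp
    then have "ln y / ln 2 \<le> (real (k + m) * T) / (1 / 2)"
      using ly T by (intro frac_le) auto
    then show ?thesis by (simp add: log_def algebra_simps)
  qed
  moreover have "real (nat \<lceil>log 2 y\<rceil>) \<le> 1 + max 0 (log 2 y)" by linarith
  moreover have "0 \<le> 2 * real (k + m) * T" using T by simp
  ultimately have "real (nat \<lceil>log 2 y\<rceil>) \<le> T + 2 * real (k + m) * T" using T by linarith
  then show ?thesis unfolding T_def by (simp add: algebra_simps)
qed

lemma length_concat_le:
  assumes "\<And>s. s \<in> set steps \<Longrightarrow> length s \<le> \<nu>"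
  shows "length (concat steps) \<le> length steps * \<nu>"
  using assms by (induction steps) (auto intro: add_mono)

text \<open>Up to constant factors, \<open>T\<close> bounds all logarithms, and \<open>\<surd>R\<close> bounds the square roots of the condition numbers.
  \<open>Lg + \<eta> + z * Lf\<close> is a Lipschitz constant of the gradient of the smooth part of the regularised
  Lagrangian.\<close>

lemma complexity_arithmetic:
  fixes Lf Lg D M \<delta> z :: real
  assumes Lf: "0 < Lf" and Lg: "1 \<le> Lg" and D: "0 \<le> D" and M: "1 \<le> M" and \<delta>: "0 < \<delta>" "\<delta> \<le> 1"
  defines "\<eta> \<equiv> \<delta> / C_D D" and "\<rho> \<equiv> \<delta> / C_\<Delta> D M" and "R \<equiv> C_D D * (Lg + M * Lf) / \<delta>"
    and "T \<equiv> (1 + ln (2 + Lf + Lg + D + M)) * (1 + ln (1 / \<delta>))"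
  shows "1 \<le> R" and "1 \<le> T"
    and "0 \<le> z \<Longrightarrow> z < 2 * M \<Longrightarrow> sqrt ((Lg + \<eta> + z * Lf) / \<eta>) \<le> 2 * sqrt R"
    and "0 \<le> z \<Longrightarrow> z < 2 * M \<Longrightarrow>
      1 + real (nat \<lceil>log 2 ((Lg + \<eta> + z * Lf) * D / (\<eta> * \<rho>\<^sup>2))\<rceil>) \<le> 40 * T"
    and "real (2 + nat \<lceil>log 2 M\<rceil> + nat \<lceil>log 2 (M / (\<eta> * \<rho> ^ 3))\<rceil>) \<le> 50 * T"
proof -
  define S where "S = 2 + Lf + Lg + D + M"
  define C where "C = C_D D"
  have S: "2 \<le> S" "D \<le> S" "M \<le> S" using assms unfolding S_def by auto
  have C1: "1 \<le> C" using D unfolding C_def C_D_def by simp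
  have "C \<le> (2 + D)\<^sup>2" using D unfolding C_def C_D_def by (simp add: power2_eq_square algebra_simps)
  also have "\<dots> \<le> S\<^sup>2" using assms unfolding S_def by (intro power_mono) auto
  finally have CS: "C \<le> S\<^sup>2" .
  have l: "0 \<le> ln S" "0 \<le> ln (1 / \<delta>)" using S \<delta> by auto
  have T': "T = (1 + ln S) * (1 + ln (1 / \<delta>))" unfolding T_def S_def ..
  \<comment> \<open>With \<open>D\<close> and \<open>M\<close> at most \<open>S\<close>, \<open>C\<close> at most \<open>S\<^sup>2\<close> and \<open>2 \<le> S\<close>, every argument of a logarithm is at most \<open>S\<close>
    to a fixed power, over a power of \<open>\<delta>\<close>.\<close>
  show T1: "1 \<le> T" unfolding T' using l mult_mono[of 1 "1 + ln S" 1 "1 + ln (1 / \<delta>)"] by simp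
  have MLf: "0 \<le> M * Lf" using M Lf by simp
  have Q1: "1 \<le> Lg + M * Lf" using MLf Lg by simp
  have \<eta>: "0 < \<eta>" "\<eta> \<le> 1" using C1 \<delta> unfolding \<eta>_def C_def[symmetric] by (auto simp: divide_le_eq)
  have \<rho>: "0 < \<rho>" using C1 \<delta> M unfolding \<rho>_def C_\<Delta>_def C_def[symmetric] by simp
  have "\<delta> * 1 \<le> C * (Lg + M * Lf)" using C1 \<delta> Q1 by (intro mult_mono) auto
  then show "1 \<le> R" using \<delta> unfolding R_def C_def[symmetric] by simp
  show "real (2 + nat \<lceil>log 2 M\<rceil> + nat \<lceil>log 2 (M / (\<eta> * \<rho> ^ 3))\<rceil>) \<le> 50 * T"
  proof -
    have "real (nat \<lceil>log 2 M\<rceil>) \<le> (1 + 2 * real (1 + 0)) * T"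
      unfolding T' using S M \<delta> by (intro real_nat_ceiling_log_le) auto
    moreover have "real (nat \<lceil>log 2 (M / (\<eta> * \<rho> ^ 3))\<rceil>) \<le> (1 + 2 * real (18 + 4)) * T"
      unfolding T'
    proof (rule real_nat_ceiling_log_le)
      have "M / (\<eta> * \<rho> ^ 3) = 2 ^ 6 * C ^ 4 * M ^ 4 / \<delta> ^ 4"
        using C1 M \<delta> unfolding \<eta>_def \<rho>_def C_\<Delta>_def C_def[symmetric]
        by (simp add: field_simps power_numeral_reduce)
      also have "2 ^ 6 * C ^ 4 * M ^ 4 \<le> S ^ 6 * (S\<^sup>2) ^ 4 * S ^ 4"
        using S CS C1 M by (intro mult_mono power_mono) auto
      also have "S ^ 6 * (S\<^sup>2) ^ 4 * S ^ 4 = S ^ 18" by (simp flip: power_mult power_add)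
      finally show "M / (\<eta> * \<rho> ^ 3) \<le> S ^ 18 / \<delta> ^ 4" using \<delta> by (simp add: divide_right_mono)
    qed (use \<eta> \<rho> M S \<delta> in auto)
    ultimately show ?thesis using T1 by simp
  qed
  assume z: "0 \<le> z" "z < 2 * M"
  have "z * Lf \<le> 2 * M * Lf" using z Lf by (intro mult_right_mono) auto
  then have L: "Lg + \<eta> + z * Lf \<le> 2 * (Lg + M * Lf)" "0 \<le> Lg + \<eta> + z * Lf"
    using \<eta> Lg Lf mult_nonneg_nonneg[OF z(1) less_imp_le[OF Lf]] by (simp_all only: distrib_left mult.assoc)
  show "sqrt ((Lg + \<eta> + z * Lf) / \<eta>) \<le> 2 * sqrt R"
  proof -
    have "(Lg + \<eta> + z * Lf) / \<eta> \<le> 2 * (Lg + M * Lf) / \<eta>"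
      using L \<eta> by (intro divide_right_mono) auto
    also have "\<dots> = 2 * R" using C1 \<delta> unfolding \<eta>_def R_def C_def[symmetric] by (simp add: field_simps)
    also have "\<dots> \<le> 2\<^sup>2 * R" using \<open>1 \<le> R\<close> by simp
    finally have "sqrt ((Lg + \<eta> + z * Lf) / \<eta>) \<le> sqrt (2\<^sup>2 * R)" by simp
    then show ?thesis by (simp add: real_sqrt_mult)
  qed
  have "real (nat \<lceil>log 2 ((Lg + \<eta> + z * Lf) * D / (\<eta> * \<rho>\<^sup>2))\<rceil>) \<le> (1 + 2 * real (16 + 3)) * T"
    unfolding T'
  proof (rule real_nat_ceiling_log_le)
    have "Lg + M * Lf \<le> S * S"
    proof -
      have "Lg + M * Lf \<le> S * Lg + S * Lf"
        using S Lg Lf mult_right_mono[of 1 S Lg] by (intro add_mono mult_right_mono) auto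
      also have "\<dots> = S * (Lg + Lf)" by (simp add: algebra_simps)
      also have "\<dots> \<le> S * S" using S assms unfolding S_def by (intro mult_left_mono) auto
      finally show ?thesis .
    qed
    then have LS: "Lg + \<eta> + z * Lf \<le> S * (S * S)"
      using L S mult_mono[of 2 S "Lg + M * Lf" "S * S"] Q1 by auto
    have "(Lg + \<eta> + z * Lf) * D / (\<eta> * \<rho>\<^sup>2) = (Lg + \<eta> + z * Lf) * D * (2 ^ 4 * C ^ 3 * M\<^sup>2) / \<delta> ^ 3"
      using C1 M \<delta> unfolding \<eta>_def \<rho>_def C_\<Delta>_def C_def[symmetric]
      by (simp add: field_simps power_numeral_reduce)
    also have "(Lg + \<eta> + z * Lf) * D * (2 ^ 4 * C ^ 3 * M\<^sup>2) \<le> S * (S * S) * S * (S ^ 4 * (S\<^sup>2) ^ 3 * S\<^sup>2)"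
      using S CS C1 M L LS D by (intro mult_mono power_mono) auto
    also have "S * (S * S) * S * (S ^ 4 * (S\<^sup>2) ^ 3 * S\<^sup>2) = S ^ 16"
      by (simp add: power_numeral_reduce algebra_simps)
    finally show "(Lg + \<eta> + z * Lf) * D / (\<eta> * \<rho>\<^sup>2) \<le> S ^ 16 / \<delta> ^ 3"
      using \<delta> by (simp add: divide_right_mono)
  qed (use L D \<eta> \<rho> S \<delta> in auto)
  then show "1 + real (nat \<lceil>log 2 ((Lg + \<eta> + z * Lf) * D / (\<eta> * \<rho>\<^sup>2))\<rceil>) \<le> 40 * T"
    using T1 by simp
qed

section \<open>The value test\<close>

text \<open>In the complexity bound, up to the common factors \<open>T\<close> and \<open>\<surd>R\<close> of the preceding lemma, the factor \<open>50\<close> counts the solver calls, \<open>80 \<nu> \<kappa>\<close> the operations in one call, and \<open>2\<close> the evaluation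
  of the constraint; \<open>max \<kappa> 0\<close> covers the degenerate case of a negative \<open>\<kappa>\<close>.\<close>

lemma VTest_correct:
  fixes f\<^sub>1 g\<^sub>1 :: "'a::euclidean_space \<Rightarrow> real" and f\<^sub>2 g\<^sub>2 :: "'a \<Rightarrow> ereal" and \<kappa> :: real and \<nu> :: nat
  assumes prob: "sbo_problem f\<^sub>1 f\<^sub>2 g\<^sub>1 g\<^sub>2 Lf Lg"
    and asmA: "assumption_A f\<^sub>1 f\<^sub>2 g\<^sub>1 g\<^sub>2 l\<^sub>f\<^sub>2"
    and diam: "diameter (edom g\<^sub>2) \<le> D"
    and B: "1 \<le> B" "B-lipschitz_on (edom g\<^sub>2) (\<lambda>x. real_of_ereal (composite f\<^sub>1 f\<^sub>2 x))"
    and cert: "reference_certificate f\<^sub>1 f\<^sub>2 g\<^sub>1 g\<^sub>2 l\<^sub>0 \<Delta> x\<^sub>f M"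
    and apg: "apg_black_box f\<^sub>1 f\<^sub>2 g\<^sub>1 g\<^sub>2 \<kappa> \<nu> apg"
    and c: "l\<^sub>0 \<le> c" and \<delta>: "0 < \<delta>" "\<delta> \<le> 1 / B" and x\<^sub>i\<^sub>n: "x\<^sub>i\<^sub>n \<in> edom g\<^sub>2"
  defines "f \<equiv> composite f\<^sub>1 f\<^sub>2" and "g \<equiv> composite g\<^sub>1 g\<^sub>2"
  shows "\<exists>x z ops. VTest apg f\<^sub>1 f\<^sub>2 g\<^sub>1 g\<^sub>2 D x\<^sub>f M c \<delta> x\<^sub>i\<^sub>n = Some ((x, z), ops) \<and>
    x \<in> edom g\<^sub>2 \<and> z \<in> {0..<2 * M} \<and> f x - ereal c \<le> ereal \<delta> \<and>
    \<bar>g x - level_value f g c\<bar> \<le> ereal \<delta> \<and>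
    dual_value f g (edom g\<^sub>2) c z \<le> level_value f g c \<and>
    g x - ereal ((D\<^sup>2 + 2) * \<delta>) < dual_value f g (edom g\<^sub>2) c z \<and>
    set ops \<subseteq> basic_operations f\<^sub>1 f\<^sub>2 g\<^sub>1 g\<^sub>2 \<and>
    real (length ops) \<le> 50 * (80 * (real \<nu> * max \<kappa> 0) + 2) * (1 + ln (2 + Lf + Lg + D + M))\<^sup>2 *
      (sqrt (C_D D * (Lg + M * Lf) / \<delta>) * (1 + ln (1 / \<delta>))\<^sup>2)"
proof -
  define X where "X = edom g\<^sub>2"
  define F G where "F x = f\<^sub>1 x + real_of_ereal (f\<^sub>2 x)" and "G x = g\<^sub>1 x + real_of_ereal (g\<^sub>2 x)" for x
  have Lf: "0 < Lf" and Lg: "1 \<le> Lg"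
    and cvx: "convex_on UNIV f\<^sub>1" "convex_on UNIV g\<^sub>1" "convex_ereal f\<^sub>2" "convex_ereal g\<^sub>2"
    and grad: "lipschitz_gradient Lf f\<^sub>1" "lipschitz_gradient Lg g\<^sub>1"
    and proper: "proper f\<^sub>2" "proper g\<^sub>2" and lsc: "lsc f\<^sub>2" "lsc g\<^sub>2"
    using prob unfolding sbo_problem_def by auto
  have Xc: "convex X" "compact X" and Xf: "edom g\<^sub>2 \<subseteq> edom f\<^sub>2"
    using asmA unfolding assumption_A_def X_def by auto
  have minf: "f\<^sub>2 x \<noteq> -\<infinity>" "g\<^sub>2 x \<noteq> -\<infinity>" for x using proper unfolding proper_def by auto
  have fin2: "f\<^sub>2 x = ereal (real_of_ereal (f\<^sub>2 x))" "g\<^sub>2 x = ereal (real_of_ereal (g\<^sub>2 x))" if "x \<in> X" for x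
  proof -
    have "f\<^sub>2 x < \<infinity>" "g\<^sub>2 x < \<infinity>" using that Xf unfolding X_def edom_def by auto
    then show "f\<^sub>2 x = ereal (real_of_ereal (f\<^sub>2 x))" "g\<^sub>2 x = ereal (real_of_ereal (g\<^sub>2 x))"
      using minf[of x] by (cases "f\<^sub>2 x"; cases "g\<^sub>2 x"; simp)+
  qed
  have fin: "\<bar>f\<^sub>2 x\<bar> \<noteq> \<infinity>" "\<bar>g\<^sub>2 x\<bar> \<noteq> \<infinity>" if "x \<in> X" for x
    by (subst fin2[OF that], simp)+
  have fX: "f x = ereal (F x)" and gX: "g x = ereal (G x)" if "x \<in> X" for x
    using fin2[OF that] unfolding f_def g_def F_def G_def composite_def
    by (metis plus_ereal.simps(1))+
  have g_out: "g x = \<infinity>" if "x \<notin> X" for x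
    using that unfolding g_def composite_def X_def edom_def by simp
  have conv: "convex_on X F" "convex_on X G"
  proof -
    have "convex_on X (\<lambda>x. real_of_ereal (f\<^sub>2 x))" "convex_on X (\<lambda>x. real_of_ereal (g\<^sub>2 x))"
      by (rule convex_on_real_part[OF cvx(3) Xc(1) fin(1)], assumption)
        (rule convex_on_real_part[OF cvx(4) Xc(1) fin(2)], assumption)
    then show "convex_on X F" "convex_on X G"
      unfolding F_def[abs_def] G_def[abs_def] using cvx Xc(1)
      by (auto intro!: convex_on_add intro: convex_on_subset)
  qed
  have lip: "B-lipschitz_on X F"
    using B(2) fX unfolding X_def f_def by (auto intro: lipschitz_on_transform)
  have diamX: "norm (x - y) \<le> D" if "x \<in> X" "y \<in> X" for x y
    using diameter_bounded_bound[of X x y] that diam Xc compact_imp_bounded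
    unfolding X_def dist_norm by force

  obtain x\<^sub>r where x\<^sub>f: "x\<^sub>f \<in> X" and l0: "ereal l\<^sub>0 = f x\<^sub>f + ereal \<Delta>" and \<Delta>: "0 < \<Delta>"
    and x\<^sub>r: "x\<^sub>r \<in> X" "g x\<^sub>r - (INF x\<in>X. g x) \<le> 1"
    and Mdef: "ereal M = max ((g x\<^sub>f - g x\<^sub>r + 1) / ereal \<Delta>) 1"
    using cert unfolding reference_certificate_def Let_def f_def g_def X_def by auto
  have M: "M = max ((G x\<^sub>f - G x\<^sub>r + 1) / \<Delta>) 1"
    using Mdef \<Delta> unfolding gX[OF x\<^sub>f] gX[OF x\<^sub>r(1)]
    by (simp add: one_ereal_def max_def split: if_splits)
  \<comment> \<open>The reference point is optimal up to \<open>1\<close>, which the summand \<open>1\<close> in the certificate makes up for.\<close>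
  have gap: "G x\<^sub>f - G y \<le> M * \<Delta>" if y: "y \<in> X" for y
  proof -
    have 1: "(INF x\<in>X. g x) \<le> ereal (G y)" using INF_lower[OF y, of g] gX[OF y] by simp
    have "G x\<^sub>r - 1 \<le> G y"
      using x\<^sub>r(2) 1 unfolding gX[OF x\<^sub>r(1)] by (cases "INF x\<in>X. g x") (auto simp: one_ereal_def)
    moreover have "(G x\<^sub>f - G x\<^sub>r + 1) / \<Delta> \<le> M" unfolding M by simp
    ultimately show ?thesis using \<Delta> by (simp add: divide_le_eq)
  qed
  have M1: "1 \<le> M" unfolding M by simp
  have slack: "F x\<^sub>f + \<Delta> \<le> c" using l0 c unfolding fX[OF x\<^sub>f] by simp

  interpret S: slater_pair X F G x\<^sub>f D B M \<Delta> c \<delta>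
    by unfold_locales (use conv diamX lip x\<^sub>f slack \<Delta> gap M1 B \<delta> in auto)
  note \<eta>_def = S.\<eta>_def and \<rho>_def = S.\<rho>_def
  let ?\<eta> = "S.\<eta>" and ?\<rho> = "S.\<rho>"
  define \<phi> where "\<phi> z x = g\<^sub>1 x + ?\<eta> / 2 * (norm (x - x\<^sub>f))\<^sup>2 + z * (f\<^sub>1 x - c)" for z x
  define \<psi> where "\<psi> = composite (\<lambda>x. f\<^sub>1 x - c) f\<^sub>2"
  define ev where "ev x = [Value (\<lambda>y. ereal (f\<^sub>1 y)) x, Value f\<^sub>2 x]" for x
  define R T where "R = C_D D * (Lg + M * Lf) / \<delta>"
    and "T = (1 + ln (2 + Lf + Lg + D + M)) * (1 + ln (1 / \<delta>))"
  note arith = complexity_arithmetic[OF Lf Lg S.D_nonneg M1 \<delta>(1) S.constants(1),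
      folded \<eta>_def \<rho>_def R_def T_def]
  define \<kappa>' where "\<kappa>' = max \<kappa> 0"
  define W where "W = (80 * (real \<nu> * \<kappa>') + 2) * (sqrt R * T)"
  have sqrtR: "1 \<le> sqrt R" using arith(1) by simp
  have RT: "1 \<le> sqrt R * T" using mult_mono[of 1 "sqrt R" 1 T] sqrtR arith(2) by simp
  have \<kappa>': "\<kappa> \<le> \<kappa>'" "0 \<le> \<kappa>'" unfolding \<kappa>'_def by auto
  have W0: "0 \<le> W" unfolding W_def using RT \<kappa>' by simp
  have \<psi>X: "\<psi> x = ereal (F x - c)" if "x \<in> X" for x
    using fin2[OF that] unfolding \<psi>_def composite_def F_def
    by (metis add_diff_eq diff_add_eq plus_ereal.simps(1))

  have call: "case apg ?\<eta> (\<phi> z) (\<lambda>x. g\<^sub>2 x + ereal z * f\<^sub>2 x) (?\<eta> * ?\<rho>\<^sup>2) x\<^sub>i\<^sub>n of (x, steps) \<Rightarrow>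
      S.near_min z x \<and> real (length (concat steps @ ev x)) \<le> W \<and>
      set (concat steps @ ev x) \<subseteq> basic_operations f\<^sub>1 f\<^sub>2 g\<^sub>1 g\<^sub>2"
    if z: "0 \<le> z" "z < 2 * M" for z
  proof -
    define \<phi>\<^sub>2 where "\<phi>\<^sub>2 x = g\<^sub>2 x + ereal z * f\<^sub>2 x" for x
    define L where "L = Lg + ?\<eta> + z * Lf"
    obtain x steps where run: "apg ?\<eta> (\<phi> z) \<phi>\<^sub>2 (?\<eta> * ?\<rho>\<^sup>2) x\<^sub>i\<^sub>n = (x, steps)" by fastforce
    have edom: "edom \<phi>\<^sub>2 = X"
      unfolding X_def \<phi>\<^sub>2_def[abs_def] by (rule edom_add_scaled[OF proper(2,1) Xf z(1)])
    have "apg_admissible ?\<eta> (\<phi> z) \<phi>\<^sub>2 (?\<eta> * ?\<rho>\<^sup>2) x\<^sub>i\<^sub>n L D"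
      unfolding apg_admissible_def edom
    proof (intro conjI)
      have "convex_on UNIV (\<lambda>x. f\<^sub>1 x - c)"
        using convex_on_add[OF cvx(1), of "\<lambda>x. - c"] by (simp add: convex_on_const)
      then have "convex_on UNIV (\<lambda>x. g\<^sub>1 x + z * (f\<^sub>1 x - c))"
        using cvx z(1) by (intro convex_on_add convex_on_cmul) auto
      from strongly_convex_add_quadratic[OF this, of ?\<eta> x\<^sub>f] show "strongly_convex ?\<eta> (\<phi> z)"
        unfolding \<phi>_def[abs_def] by (simp add: add_ac)
      show "lipschitz_gradient L (\<phi> z)"
        unfolding \<phi>_def[abs_def] L_def using grad S.constants z
        by (intro lipschitz_gradient_add_quadratic) auto
      show "proper \<phi>\<^sub>2" unfolding \<phi>\<^sub>2_def[abs_def] by (rule proper_add_scaled[OF proper(2,1) Xf z(1)])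
      show "lsc \<phi>\<^sub>2" unfolding \<phi>\<^sub>2_def[abs_def]
        using lsc minf z(1) scaled_neq_minf by (intro lsc_add lsc_scaled) auto
      show "convex_ereal \<phi>\<^sub>2" unfolding \<phi>\<^sub>2_def[abs_def]
        by (rule convex_ereal_add_scaled[OF cvx(4,3) z(1)])
    qed (use S.constants Xc compact_imp_bounded diam x\<^sub>i\<^sub>n X_def in auto)
    then have "case apg ?\<eta> (\<phi> z) \<phi>\<^sub>2 (?\<eta> * ?\<rho>\<^sup>2) x\<^sub>i\<^sub>n of (y, steps) \<Rightarrow>
        y \<in> edom \<phi>\<^sub>2 \<and>
        subdifferential (composite (\<phi> z) \<phi>\<^sub>2) y \<noteq> {} \<and>
        infdist 0 (subdifferential (composite (\<phi> z) \<phi>\<^sub>2) y) \<le> ?\<eta> * ?\<rho>\<^sup>2 \<and>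
        real (length steps) \<le> \<kappa> * (sqrt (L / ?\<eta>) * (1 + real (nat \<lceil>log 2 (L * D / (?\<eta> * ?\<rho>\<^sup>2))\<rceil>))) \<and>
        (oracle_smooth f\<^sub>1 g\<^sub>1 (\<phi> z) \<and> oracle_prox f\<^sub>1 f\<^sub>2 g\<^sub>1 g\<^sub>2 \<phi>\<^sub>2 \<longrightarrow>
          (\<forall>s\<in>set steps. set s \<subseteq> basic_operations f\<^sub>1 f\<^sub>2 g\<^sub>1 g\<^sub>2 \<and> length s \<le> \<nu>))"
      by (rule apg[unfolded apg_black_box_def, rule_format])
    moreover have "oracle_smooth f\<^sub>1 g\<^sub>1 (\<phi> z)"
      unfolding oracle_smooth_def
      using z(1) S.constants(2)
      by (intro exI[of _ 1] exI[of _ z] exI[of _ ?\<eta>] exI[of _ x\<^sub>f] exI[of _ "- (z * c)"] conjI)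
        (auto simp: \<phi>_def fun_eq_iff algebra_simps)
    moreover have "oracle_prox f\<^sub>1 f\<^sub>2 g\<^sub>1 g\<^sub>2 \<phi>\<^sub>2"
      unfolding oracle_prox_def basic_operations_def \<phi>\<^sub>2_def[abs_def] using z(1) by blast
    ultimately have x: "x \<in> X" and ne: "subdifferential (composite (\<phi> z) \<phi>\<^sub>2) x \<noteq> {}"
      and dist: "infdist 0 (subdifferential (composite (\<phi> z) \<phi>\<^sub>2) x) \<le> ?\<eta> * ?\<rho>\<^sup>2"
      and len: "real (length steps) \<le>
        \<kappa> * (sqrt (L / ?\<eta>) * (1 + real (nat \<lceil>log 2 (L * D / (?\<eta> * ?\<rho>\<^sup>2))\<rceil>)))"
      and steps: "\<And>s. s \<in> set steps \<Longrightarrow> set s \<subseteq> basic_operations f\<^sub>1 f\<^sub>2 g\<^sub>1 g\<^sub>2 \<and> length s \<le> \<nu>"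
      unfolding run edom by auto
    obtain v where v: "v \<in> subdifferential (composite (\<phi> z) \<phi>\<^sub>2) x" "norm v \<le> ?\<eta> * ?\<rho>\<^sup>2"
      using infdist_attains_inf[OF closed_subdifferential ne, of 0] dist by (metis dist_0_norm)
    have lag: "composite (\<phi> z) \<phi>\<^sub>2 y = ereal (S.lagrangian z y)" if y: "y \<in> X" for y
    proof -
      obtain p q where "f\<^sub>2 y = ereal p" "g\<^sub>2 y = ereal q" using fin2[OF y] by blast
      then show ?thesis
        unfolding composite_def \<phi>_def \<phi>\<^sub>2_def S.lagrangian_def F_def G_def by (simp add: algebra_simps)
    qed
    have "S.near_min z x"
    proof (rule S.near_minI[OF x v(2) z(1)])
      fix y assume y: "y \<in> X"
      have "composite (\<phi> z) \<phi>\<^sub>2 x + ereal (v \<bullet> (y - x)) \<le> composite (\<phi> z) \<phi>\<^sub>2 y"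
        using v(1) unfolding subdifferential_def by blast
      then show "S.lagrangian z x + v \<bullet> (y - x) \<le> S.lagrangian z y"
        unfolding lag[OF x] lag[OF y] by simp
    qed
    moreover have "real (length (concat steps @ ev x)) \<le> W"
    proof -
      have "0 \<le> L" using Lg Lf z S.constants unfolding L_def by simp
      then have pos: "0 \<le> sqrt (L / ?\<eta>)" using S.constants by simp
      have "real (length steps) \<le> \<kappa> * (sqrt (L / ?\<eta>) * (1 + real (nat \<lceil>log 2 (L * D / (?\<eta> * ?\<rho>\<^sup>2))\<rceil>)))"
        by (rule len)
      also have "\<dots> \<le> \<kappa>' * (2 * sqrt R * (40 * T))"
        using \<kappa>' pos arith(3)[OF z] arith(4)[OF z] arith(1) unfolding L_def[symmetric]
        by (intro mult_mono) auto
      finally have s: "real (length steps) \<le> \<kappa>' * (2 * sqrt R * (40 * T))" .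
      have "length (concat steps) \<le> length steps * \<nu>" using steps by (intro length_concat_le) auto
      then have "real (length (concat steps)) \<le> real (length steps) * real \<nu>"
        by (metis of_nat_le_iff of_nat_mult)
      also have "\<dots> \<le> \<kappa>' * (2 * sqrt R * (40 * T)) * real \<nu>" using s by (intro mult_right_mono) auto
      finally have "real (length (concat steps @ ev x)) \<le> 80 * (real \<nu> * \<kappa>') * (sqrt R * T) + 2"
        unfolding ev_def by (simp add: algebra_simps)
      also have "\<dots> \<le> 80 * (real \<nu> * \<kappa>') * (sqrt R * T) + 2 * (sqrt R * T)" using RT by simp
      also have "\<dots> = W" unfolding W_def by (simp add: algebra_simps)
      finally show ?thesis .
    qed
    moreover have "set (concat steps @ ev x) \<subseteq> basic_operations f\<^sub>1 f\<^sub>2 g\<^sub>1 g\<^sub>2"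
    proof -
      have "set (ev x) \<subseteq> basic_operations f\<^sub>1 f\<^sub>2 g\<^sub>1 g\<^sub>2"
        unfolding ev_def basic_operations_def by auto
      then show ?thesis using steps by auto
    qed
    ultimately show ?thesis unfolding \<phi>\<^sub>2_def[symmetric] run by simp
  qed

  have in_X: "x \<in> X" if "S.near_min z x" for z x using that by (simp add: S.near_min_def)
  have \<psi>_max: "max (\<psi> x) 0 \<le> ereal ?\<rho> \<longleftrightarrow> F x - c \<le> ?\<rho>" if "S.near_min z x" for z x
    using S.constants(5) unfolding \<psi>X[OF in_X[OF that]] by simp
  have "\<exists>x z tr. Dual apg ev (\<lambda>x. g\<^sub>1 x + ?\<eta> / 2 * (norm (x - x\<^sub>f))\<^sup>2) g\<^sub>2 ?\<eta> (\<lambda>x. f\<^sub>1 x - c) f\<^sub>2 1 M x\<^sub>i\<^sub>n ?\<rho>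
        = Some ((x, z), tr) \<and>
      0 \<le> z \<and> z < 2 * M \<and> S.near_min z x \<and> max (composite (\<lambda>x. f\<^sub>1 x - c) f\<^sub>2 x) 0 \<le> ereal ?\<rho> \<and>
      \<bar>ereal z * composite (\<lambda>x. f\<^sub>1 x - c) f\<^sub>2 x\<bar> \<le> ereal (4 * M * ?\<rho>) \<and>
      set tr \<subseteq> basic_operations f\<^sub>1 f\<^sub>2 g\<^sub>1 g\<^sub>2 \<and>
      real (length tr) \<le> real (2 + nat \<lceil>log 2 M\<rceil> + nat \<lceil>log 2 (M / (?\<eta> * ?\<rho> ^ 3))\<rceil>) * W"
  proof (rule Dual_terminates)
    show "case apg ?\<eta> (\<lambda>x. g\<^sub>1 x + ?\<eta> / 2 * (norm (x - x\<^sub>f))\<^sup>2 + z * (f\<^sub>1 x - c))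
        (\<lambda>x. g\<^sub>2 x + ereal z * f\<^sub>2 x) (?\<eta> * ?\<rho>\<^sup>2) x\<^sub>i\<^sub>n of (x, steps) \<Rightarrow>
      S.near_min z x \<and> real (length (concat steps @ ev x)) \<le> W \<and>
      set (concat steps @ ev x) \<subseteq> basic_operations f\<^sub>1 f\<^sub>2 g\<^sub>1 g\<^sub>2"
      if "0 \<le> z" "z < 2 * M" for z
      using call[OF that] unfolding \<phi>_def[abs_def] .
    show "max (composite (\<lambda>x. f\<^sub>1 x - c) f\<^sub>2 x) 0 \<le> ereal ?\<rho>"
      if "M \<le> z" "z < 2 * M" "S.near_min z x" for z x
      using S.near_min_large_multiplier[OF that(3,1)] \<psi>_max[OF that(3)] unfolding \<psi>_def by simp
    show "?\<eta> * ?\<rho> ^ 3 < b - a"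
      if "0 \<le> a" "a < b" "b < 2 * M" "S.near_min a x" "S.near_min b y"
        "max (composite (\<lambda>x. f\<^sub>1 x - c) f\<^sub>2 x) 0 > ereal ?\<rho>"
        "max (composite (\<lambda>x. f\<^sub>1 x - c) f\<^sub>2 y) 0 \<le> ereal ?\<rho>"
        "\<bar>ereal b * composite (\<lambda>x. f\<^sub>1 x - c) f\<^sub>2 y\<bar> > ereal (4 * M * ?\<rho>)" for a b x y
    proof (rule S.near_min_separation[OF that(4,5,1,2,3)])
      show "?\<rho> < F x - c" using that(6) \<psi>_max[OF that(4)] unfolding \<psi>_def by (metis not_le)
      show "F y - c \<le> ?\<rho>" using that(7) \<psi>_max[OF that(5)] unfolding \<psi>_def by simp
      show "4 * M * ?\<rho> < \<bar>b * (F y - c)\<bar>"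
        using that(8) unfolding \<psi>_def[symmetric] \<psi>X[OF in_X[OF that(5)]] by simp
    qed
  qed (use W0 M1 S.constants in auto)
  then obtain x z tr where
    D: "Dual apg ev (\<lambda>x. g\<^sub>1 x + ?\<eta> / 2 * (norm (x - x\<^sub>f))\<^sup>2) g\<^sub>2 ?\<eta> (\<lambda>x. f\<^sub>1 x - c) f\<^sub>2 1 M x\<^sub>i\<^sub>n ?\<rho>
        = Some ((x, z), tr)"
    and z: "0 \<le> z" "z < 2 * M" and nm: "S.near_min z x"
    and feas: "max (\<psi> x) 0 \<le> ereal ?\<rho>" and comp: "\<bar>ereal z * \<psi> x\<bar> \<le> ereal (4 * M * ?\<rho>)"
    and tr: "set tr \<subseteq> basic_operations f\<^sub>1 f\<^sub>2 g\<^sub>1 g\<^sub>2"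
      "real (length tr) \<le> real (2 + nat \<lceil>log 2 M\<rceil> + nat \<lceil>log 2 (M / (?\<eta> * ?\<rho> ^ 3))\<rceil>) * W"
    unfolding \<psi>_def by blast
  have x: "x \<in> X" by (rule in_X[OF nm])
  have Fx: "F x - c \<le> ?\<rho>" using feas \<psi>_max[OF nm] by simp
  have comp': "\<bar>z * (F x - c)\<bar> \<le> ?\<eta>" using comp unfolding \<psi>X[OF x] S.constants(6) by simp

  have VT: "VTest apg f\<^sub>1 f\<^sub>2 g\<^sub>1 g\<^sub>2 D x\<^sub>f M c \<delta> x\<^sub>i\<^sub>n = Some ((x, z), tr)"
    using D unfolding VTest_def Let_def \<eta>_def \<rho>_def ev_def[abs_def] .
  have \<rho>\<delta>: "?\<rho> \<le> \<delta>" using S.constants M1 mult_right_mono[of 1 "4 * M" ?\<rho>] by simp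
  have dual_lower: "ereal (G x - \<delta>) \<le> dual_value f g X c z"
    unfolding dual_value_def
  proof (rule INF_greatest)
    fix y assume y: "y \<in> X"
    then show "ereal (G x - \<delta>) \<le> g y + ereal z * (f y - ereal c)"
      using S.near_min_dual_gap[OF nm comp' y] unfolding fX[OF y] gX[OF y] by simp
  qed
  have weak_duality: "dual_value f g X c z \<le> level_value f g c"
    unfolding level_value_def
  proof (rule INF_greatest)
    fix y assume "y \<in> {y. f y \<le> ereal c}"
    then have fy: "f y \<le> ereal c" by simp
    show "dual_value f g X c z \<le> g y"
    proof (cases "y \<in> X")
      case True
      have "dual_value f g X c z \<le> g y + ereal z * (f y - ereal c)"
        unfolding dual_value_def by (rule INF_lower[OF True])
      also have "\<dots> \<le> g y"
        using fy z(1) unfolding fX[OF True] gX[OF True] by (simp add: mult_nonneg_nonpos)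
      finally show ?thesis .
    qed (simp add: g_out)
  qed
  obtain y where y: "y \<in> X" "F y \<le> c" "G y \<le> G x + \<delta>" using S.feasible_point_nearby[OF x Fx] by blast
  have "level_value f g c \<le> g y"
    unfolding level_value_def using y by (intro INF_lower) (simp add: fX)
  also have "\<dots> \<le> ereal (G x + \<delta>)" using y by (simp add: gX)
  finally have upper: "level_value f g c \<le> ereal (G x + \<delta>)" .
  have lower: "ereal (G x - \<delta>) \<le> level_value f g c" using dual_lower weak_duality by (rule order_trans)
  have level_gap: "\<bar>g x - level_value f g c\<bar> \<le> ereal \<delta>"
    using lower upper unfolding gX[OF x] by (cases "level_value f g c") auto
  have "g x - ereal ((D\<^sup>2 + 2) * \<delta>) < ereal (G x - \<delta>)"
  proof -
    have "0 \<le> D\<^sup>2 * \<delta>" using \<delta>(1) by simp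
    then have "\<delta> < (D\<^sup>2 + 2) * \<delta>" using \<delta>(1) unfolding distrib_right by linarith
    then show ?thesis unfolding gX[OF x] by simp
  qed
  then have strict: "g x - ereal ((D\<^sup>2 + 2) * \<delta>) < dual_value f g X c z"
    using dual_lower by (rule less_le_trans)
  have "real (length tr) \<le> 50 * T * W"
    using tr(2) mult_right_mono[OF arith(5) W0] by linarith
  also have "\<dots> = 50 * (80 * (real \<nu> * max \<kappa> 0) + 2) * (1 + ln (2 + Lf + Lg + D + M))\<^sup>2 *
      (sqrt (C_D D * (Lg + M * Lf) / \<delta>) * (1 + ln (1 / \<delta>))\<^sup>2)"
    unfolding W_def T_def R_def \<kappa>'_def by (simp add: power2_eq_square algebra_simps)
  finally have "real (length tr) \<le> 50 * (80 * (real \<nu> * max \<kappa> 0) + 2) * (1 + ln (2 + Lf + Lg + D + M))\<^sup>2 *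
      (sqrt (C_D D * (Lg + M * Lf) / \<delta>) * (1 + ln (1 / \<delta>))\<^sup>2)" .
  moreover have "f x - ereal c \<le> ereal \<delta>" using Fx \<rho>\<delta> unfolding fX[OF x] by simp
  ultimately show ?thesis
    using VT x z level_gap weak_duality strict tr(1) unfolding X_def by auto
qed

theorem lemma2p6:
  fixes \<kappa> :: real and \<nu> :: nat
  shows "\<exists>K>0. \<forall>(f\<^sub>1 :: real ^ 'n \<Rightarrow> real) f\<^sub>2 g\<^sub>1 g\<^sub>2 Lf Lg l\<^sub>f\<^sub>2 D\<^sub>g B\<^sub>f l\<^sub>0 \<Delta> x\<^sub>f M apg.
    sbo_problem f\<^sub>1 f\<^sub>2 g\<^sub>1 g\<^sub>2 Lf Lg \<longrightarrow>
    assumption_A f\<^sub>1 f\<^sub>2 g\<^sub>1 g\<^sub>2 l\<^sub>f\<^sub>2 \<longrightarrow>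
    diameter (edom g\<^sub>2) \<le> D\<^sub>g \<longrightarrow>
    1 \<le> B\<^sub>f \<longrightarrow>
    B\<^sub>f-lipschitz_on (edom g\<^sub>2) (\<lambda>x. real_of_ereal (composite f\<^sub>1 f\<^sub>2 x)) \<longrightarrow>
    reference_certificate f\<^sub>1 f\<^sub>2 g\<^sub>1 g\<^sub>2 l\<^sub>0 \<Delta> x\<^sub>f M \<longrightarrow>
    apg_black_box f\<^sub>1 f\<^sub>2 g\<^sub>1 g\<^sub>2 \<kappa> \<nu> apg \<longrightarrow>
    (\<forall>c \<delta> x\<^sub>i\<^sub>n. l\<^sub>0 \<le> c \<longrightarrow> 0 < \<delta> \<longrightarrow> \<delta> \<le> 1 / B\<^sub>f \<longrightarrow> x\<^sub>i\<^sub>n \<in> edom g\<^sub>2 \<longrightarrow>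
      (let f = composite f\<^sub>1 f\<^sub>2; g = composite g\<^sub>1 g\<^sub>2 in
        \<exists>x\<^sub>c z\<^sub>c ops.
          VTest apg f\<^sub>1 f\<^sub>2 g\<^sub>1 g\<^sub>2 D\<^sub>g x\<^sub>f M c \<delta> x\<^sub>i\<^sub>n = Some ((x\<^sub>c, z\<^sub>c), ops) \<and>
          x\<^sub>c \<in> edom g\<^sub>2 \<and>
          z\<^sub>c \<in> {0..<2 * M} \<and>
          f x\<^sub>c - ereal c \<le> ereal \<delta> \<and>
          \<bar>g x\<^sub>c - level_value f g c\<bar> \<le> ereal \<delta> \<and>
          dual_value f g (edom g\<^sub>2) c z\<^sub>c \<le> level_value f g c \<and>
          g x\<^sub>c - ereal ((D\<^sub>g\<^sup>2 + 2) * \<delta>) < dual_value f g (edom g\<^sub>2) c z\<^sub>c \<and>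
          set ops \<subseteq> basic_operations f\<^sub>1 f\<^sub>2 g\<^sub>1 g\<^sub>2 \<and>
          real (length ops) \<le>
            K * (1 + ln (2 + Lf + Lg + D\<^sub>g + M))\<^sup>2 *
              (sqrt (C_D D\<^sub>g * (Lg + M * Lf) / \<delta>) * (1 + ln (1 / \<delta>))\<^sup>2)))"
proof (intro exI[of _ "50 * (80 * (real \<nu> * max \<kappa> 0) + 2)"] conjI allI impI, goal_cases)
  case 1
  show ?case by (intro mult_pos_pos add_nonneg_pos mult_nonneg_nonneg) auto
next
  case (2 f\<^sub>1 f\<^sub>2 g\<^sub>1 g\<^sub>2 Lf Lg l\<^sub>f\<^sub>2 D\<^sub>g B\<^sub>f l\<^sub>0 \<Delta> x\<^sub>f M apg c \<delta> x\<^sub>i\<^sub>n)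
  then show ?case unfolding Let_def by (rule VTest_correct)
qed

end
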